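(* Let $E$ be a quasi-Banach ideal space with the Fatou property over $(T,\Sigma,\mu)$ and let $\varphi$ be an Orlicz function with $a_\varphi<b_\varphi$ and $\alpha^E_\varphi>0$. Suppose one of the following three conditions holds: (i) neither $L_\infty\subset E$ nor $E\subset L_\infty$, and $\varphi\in\Delta_\varepsilon(\mathbb R_+)$; (ii) $L_\infty\subset E$, and either $\varphi\in\Delta_\varepsilon(\mathbb R_+)$, or [$\varphi\in\Delta_\varepsilon(\infty)$, $\varphi$ is strictly increasing on the interval $(a_\varphi,b_\varphi)$ and $E$ is a rearrangement invariant Banach space over $T=(0,1)$ or $T=(0,\infty)$ with $\mu$ being the Lebesgue measure such that $\operatorname{supp}E_a=\operatorname{supp}E$]; (iii) $E\subset L_\infty$, $\varphi\in\Delta_\varepsilon(0)$ and $\varphi$ is strictly increasing on the interval $(a_\varphi,\min(\varphi^{-1}(1/a_E),b_\varphi))$. If $E$ contains an order linearly isometric copy of $l_\infty$, then $E_\varphi$ also contains such a copy.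
   Context: $(T,\Sigma,\mu)$ is a complete $\sigma$-finite measure space with $\mu(T)>0$; $L^0$ is the space of ($\mu$-a.e. classes of) real $\Sigma$-measurable functions on $T$, with the a.e. order; $L_\infty=L_\infty(T,\Sigma,\mu)$. A quasi-norm is a functional satisfying the axioms of a norm with the triangle inequality replaced by $\|x+y\|\le C(\|x\|+\|y\|)$ for some constant $C\ge1$. A quasi-Banach ideal space is a linear subspace $E\subset L^0$ with a complete quasi-norm $\|\cdot\|_E$ such that (i) $x\in L^0$, $y\in E$, $|x|\le|y|$ a.e. imply $x\in E$, $\|x\|_E\le\|y\|_E$; (ii) some $x\in E$ is strictly positive on $T$. $E$ has the Fatou property if $0\le x_n\uparrow|x|$ a.e., $x_n\in E$, $x\in L^0$, $\sup_n\|x_n\|_E<\infty$ imply $x\in E$ and $\|x_n\|_E\to\|x\|_E$. $E_a$ is the set (an order ideal) of order continuous elements: those $x\in E$ such that $\|x_n\|_E\to0$ whenever $0\le x_n\le|x|$ and $x_n\to0$ a.e. The support of an order ideal $F\subset L^0$ is the smallest (up to null sets) $S\in\Sigma$ such that every $x\in F$ vanishes a.e. outside $S$. $E$ is a rearrangement invariant Banach space if $\|\cdot\|_E$ is a norm and, whenever $x\in E$, $y\in L^0$ and $|x|,|y|$ have the same distribution function, then $y\in E$ and $\|y\|_E=\|x\|_E$. An Orlicz function is a non-decreasing $\varphi:[0,\infty)\to[0,\infty]$ with $\varphi(0)=0$, right continuous at $0$, continuous on $(0,b_\varphi)$ and left continuous at $b_\varphi$, where $b_\varphi=\sup\{u\ge0:\varphi(u)<\infty\}$,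 and with $\lim_{u\to\infty}\varphi(u)=\infty$. $a_\varphi=\sup\{u\ge0:\varphi(u)=0\}$; $\varphi^{-1}(v)=\inf\{u\ge0:\varphi(u)>v\}$ for $v\in[0,\infty)$. For $E\subset L_\infty$, $a_E=\inf\{\|\chi_A\|_E:\chi_A\in E,\ \mu(A)>0\}$, which is positive. $\varphi\in\Delta_\varepsilon(\mathbb R_+)$: for any $\varepsilon\in(0,1)$ there is $\delta=\delta(\varepsilon)\in(0,1)$ with $\varphi(\varepsilon u)\le\delta\varphi(u)$ for all $u\ge0$. $\varphi\in\Delta_\varepsilon(\infty)$ [$\Delta_\varepsilon(0)$]: for any $\varepsilon\in(0,1)$ there are $\delta\in(0,1)$ and $u_0>0$ (depending on $\varepsilon$) such that this inequality holds for all $u\ge u_0$ [$0\le u\le u_0$]. Indices: $\alpha^a_\varphi$ is the supremum of $p\in\mathbb R$ for which there is $K\ge1$ with $\varphi(au)\le Ka^p\varphi(u)$ for all $u\ge0$, $0<a\le1$; $\alpha^\infty_\varphi$ is the same with the inequality required only for $u\ge u_0$, for some $u_0>0$ with $\varphi(u_0)<\infty$; $\alpha^0_\varphi$ is the same with the inequality required only for $0\le u\le u_0$, for some $u_0>0$. $\alpha^E_\varphi=\alpha^a_\varphi$ if neither $L_\infty\subset E$ nor $E\subset L_\infty$; $\alpha^E_\varphi=\alpha^\infty_\varphi$ if $L_\infty\subset E$; $\alpha^E_\varphi=\alpha^0_\varphi$ if $E\subset L_\infty$ (if $E=L_\infty$ as sets, either of the last two). $\rho^E_\varphi(x)=\|\varphi(|x|)\|_E$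 if $\varphi(|x|)\in E$, and $=\infty$ otherwise; $E_\varphi=\{x\in L^0:\rho^E_\varphi(\lambda x)<\infty\text{ for some }\lambda>0\}$ with the quasi-norm $\|x\|_\varphi=\inf\{\lambda>0:\rho^E_\varphi(x/\lambda)\le1\}$. A quasi-normed ideal space $F$ contains an order linearly isometric copy of $l_\infty$ if there is a linear map $P:l_\infty\to F$ with $\|Pz\|_F=\|z\|_{l_\infty}$ and $|Pz|=P|z|$ for all $z\in l_\infty$. *)

theory Defs
  imports "HOL-Analysis.Analysis"
begin

text \<open>
  Elements of \<open>L\<^sup>0\<close> are represented by measurable functions; identities and inequalities in \<open>L\<^sup>0\<close>
  are required almost everywhere.  A space is a pair of a set \<open>E\<close> of functions and a functional
  \<open>N\<close>, of which only the values on \<open>E\<close> matter.  The ideal property below makes \<open>E\<close> and \<open>N\<close>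
  invariant under changes on null sets.
\<close>

definition base_measure_space :: "'a measure \<Rightarrow> bool" where
  "base_measure_space M \<longleftrightarrow>
     complete_measure M \<and> sigma_finite_measure M \<and> emeasure M (space M) > 0"

definition Linf :: "'a measure \<Rightarrow> ('a \<Rightarrow> real) set" where
  "Linf M = {x \<in> borel_measurable M. \<exists>c. AE t in M. \<bar>x t\<bar> \<le> c}"


subsection \<open>Quasi-Banach ideal spaces\<close>

definition L0_subspace :: "'a measure \<Rightarrow> ('a \<Rightarrow> real) set \<Rightarrow> bool" where
  "L0_subspace M E \<longleftrightarrow>
     E \<subseteq> borel_measurable M \<and> (\<lambda>t. 0) \<in> E \<and>
     (\<forall>x\<in>E. \<forall>y\<in>E. (\<lambda>t. x t + y t) \<in> E) \<and>
     (\<forall>c. \<forall>x\<in>E. (\<lambda>t. c * x t) \<in> E)"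

definition quasi_norm_const ::
  "'a measure \<Rightarrow> ('a \<Rightarrow> real) set \<Rightarrow> (('a \<Rightarrow> real) \<Rightarrow> real) \<Rightarrow> real \<Rightarrow> bool" where
  "quasi_norm_const M E N C \<longleftrightarrow>
     (\<forall>x\<in>E. N x \<ge> 0) \<and>
     (\<forall>x\<in>E. N x = 0 \<longleftrightarrow> (AE t in M. x t = 0)) \<and>
     (\<forall>c. \<forall>x\<in>E. N (\<lambda>t. c * x t) = \<bar>c\<bar> * N x) \<and>
     (\<forall>x\<in>E. \<forall>y\<in>E. N (\<lambda>t. x t + y t) \<le> C * (N x + N y))"

definition quasi_norm_on ::
  "'a measure \<Rightarrow> ('a \<Rightarrow> real) set \<Rightarrow> (('a \<Rightarrow> real) \<Rightarrow> real) \<Rightarrow> bool" where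
  "quasi_norm_on M E N \<longleftrightarrow> (\<exists>C\<ge>1. quasi_norm_const M E N C)"

definition norm_on ::
  "'a measure \<Rightarrow> ('a \<Rightarrow> real) set \<Rightarrow> (('a \<Rightarrow> real) \<Rightarrow> real) \<Rightarrow> bool" where
  "norm_on M E N \<longleftrightarrow> quasi_norm_const M E N 1"

definition complete_on :: "('a \<Rightarrow> real) set \<Rightarrow> (('a \<Rightarrow> real) \<Rightarrow> real) \<Rightarrow> bool" where
  "complete_on E N \<longleftrightarrow>
     (\<forall>x :: nat \<Rightarrow> 'a \<Rightarrow> real.
        (\<forall>n. x n \<in> E) \<and> (\<forall>e>0. \<exists>k. \<forall>m\<ge>k. \<forall>n\<ge>k. N (\<lambda>t. x m t - x n t) < e) \<longrightarrow>
        (\<exists>y\<in>E. (\<lambda>n. N (\<lambda>t. x n t - y t)) \<longlonglongrightarrow> 0))"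

definition quasi_Banach_ideal_space ::
  "'a measure \<Rightarrow> ('a \<Rightarrow> real) set \<Rightarrow> (('a \<Rightarrow> real) \<Rightarrow> real) \<Rightarrow> bool" where
  "quasi_Banach_ideal_space M E N \<longleftrightarrow>
     L0_subspace M E \<and> quasi_norm_on M E N \<and> complete_on E N \<and>
     (\<forall>x\<in>borel_measurable M. \<forall>y\<in>E.
        (AE t in M. \<bar>x t\<bar> \<le> \<bar>y t\<bar>) \<longrightarrow> x \<in> E \<and> N x \<le> N y) \<and>
     (\<exists>x\<in>E. AE t in M. x t > 0)"

definition Fatou_property ::
  "'a measure \<Rightarrow> ('a \<Rightarrow> real) set \<Rightarrow> (('a \<Rightarrow> real) \<Rightarrow> real) \<Rightarrow> bool" where
  "Fatou_property M E N \<longleftrightarrow>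
     (\<forall>X :: nat \<Rightarrow> 'a \<Rightarrow> real. \<forall>x\<in>borel_measurable M.
        (\<forall>n. X n \<in> E) \<and>
        (AE t in M. (\<forall>n. 0 \<le> X n t) \<and> incseq (\<lambda>n. X n t) \<and> (\<lambda>n. X n t) \<longlonglongrightarrow> \<bar>x t\<bar>) \<and>
        bdd_above (range (\<lambda>n. N (X n))) \<longrightarrow>
        x \<in> E \<and> (\<lambda>n. N (X n)) \<longlonglongrightarrow> N x)"

definition order_cont_part ::
  "'a measure \<Rightarrow> ('a \<Rightarrow> real) set \<Rightarrow> (('a \<Rightarrow> real) \<Rightarrow> real) \<Rightarrow> ('a \<Rightarrow> real) set" where
  "order_cont_part M E N =
     {x \<in> E. \<forall>X :: nat \<Rightarrow> 'a \<Rightarrow> real.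
        (\<forall>n. X n \<in> borel_measurable M) \<and>
        (\<forall>n. AE t in M. 0 \<le> X n t \<and> X n t \<le> \<bar>x t\<bar>) \<and>
        (AE t in M. (\<lambda>n. X n t) \<longlonglongrightarrow> 0) \<longrightarrow>
        (\<lambda>n. N (X n)) \<longlonglongrightarrow> 0}"

text \<open>Supports are determined only up to null sets, hence a relation.\<close>

definition is_support :: "'a measure \<Rightarrow> ('a \<Rightarrow> real) set \<Rightarrow> 'a set \<Rightarrow> bool" where
  "is_support M F S \<longleftrightarrow>
     S \<in> sets M \<and> (\<forall>x\<in>F. AE t in M. t \<notin> S \<longrightarrow> x t = 0) \<and>
     (\<forall>S'\<in>sets M. (\<forall>x\<in>F. AE t in M. t \<notin> S' \<longrightarrow> x t = 0) \<longrightarrow> S - S' \<in> null_sets M)"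

definition same_support ::
  "'a measure \<Rightarrow> ('a \<Rightarrow> real) set \<Rightarrow> ('a \<Rightarrow> real) set \<Rightarrow> bool" where
  "same_support M F G \<longleftrightarrow> (\<exists>S. is_support M F S \<and> is_support M G S)"

definition equimeasurable :: "'a measure \<Rightarrow> ('a \<Rightarrow> real) \<Rightarrow> ('a \<Rightarrow> real) \<Rightarrow> bool" where
  "equimeasurable M x y \<longleftrightarrow>
     (\<forall>s\<ge>0. emeasure M {t \<in> space M. \<bar>x t\<bar> > s} = emeasure M {t \<in> space M. \<bar>y t\<bar> > s})"

definition ri_Banach_space ::
  "'a measure \<Rightarrow> ('a \<Rightarrow> real) set \<Rightarrow> (('a \<Rightarrow> real) \<Rightarrow> real) \<Rightarrow> bool" where
  "ri_Banach_space M E N \<longleftrightarrow>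
     quasi_Banach_ideal_space M E N \<and> norm_on M E N \<and>
     (\<forall>x\<in>E. \<forall>y\<in>borel_measurable M. equimeasurable M x y \<longrightarrow> y \<in> E \<and> N y = N x)"

text \<open>
  The points of a general \<open>M\<close> have an arbitrary type, so being the interval \<open>I\<close> with Lebesgue
  measure is expressed up to a relabelling of points: a bijection that is measurable in both
  directions and measure preserving.  For \<open>M = lebesgue_on I\<close> the identity is such a bijection.
\<close>

definition is_Lebesgue_on :: "'a measure \<Rightarrow> real set \<Rightarrow> bool" where
  "is_Lebesgue_on M I \<longleftrightarrow>
     (\<exists>f. bij_betw f (space M) I \<and>
          f \<in> measurable M (lebesgue_on I) \<and>
          inv_into (space M) f \<in> measurable (lebesgue_on I) M \<and>
          distr M (lebesgue_on I) f = lebesgue_on I)"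

definition a_const ::
  "'a measure \<Rightarrow> ('a \<Rightarrow> real) set \<Rightarrow> (('a \<Rightarrow> real) \<Rightarrow> real) \<Rightarrow> real" where
  "a_const M E N =
     Inf {N (indicator A) | A. A \<in> sets M \<and> indicator A \<in> E \<and> emeasure M A > 0}"

text \<open>
  \<open>l\<^sub>\<infinity>\<close> is the set of bounded real sequences; linearity and \<open>|P z| = P |z|\<close> are identities
  between classes of functions.
\<close>

definition contains_linf_copy ::
  "'a measure \<Rightarrow> ('a \<Rightarrow> real) set \<Rightarrow> (('a \<Rightarrow> real) \<Rightarrow> real) \<Rightarrow> bool" where
  "contains_linf_copy M F N \<longleftrightarrow>
     (\<exists>P :: (nat \<Rightarrow> real) \<Rightarrow> 'a \<Rightarrow> real.
        (\<forall>z. bounded (range z) \<longrightarrow>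
           P z \<in> F \<and> N (P z) = (SUP n. \<bar>z n\<bar>) \<and>
           (AE t in M. \<bar>P z t\<bar> = P (\<lambda>n. \<bar>z n\<bar>) t)) \<and>
        (\<forall>z w c d. bounded (range z) \<and> bounded (range w) \<longrightarrow>
           (AE t in M. P (\<lambda>n. c * z n + d * w n) t = c * P z t + d * P w t)))"


subsection \<open>Orlicz functions\<close>

text \<open>Orlicz functions live on \<open>[0,\<infinity>)\<close>; values at negative arguments are never used.\<close>

definition b_phi :: "(real \<Rightarrow> ennreal) \<Rightarrow> ereal" where
  "b_phi \<phi> = (SUP u \<in> {u. 0 \<le> u \<and> \<phi> u < \<infinity>}. ereal u)"

definition a_phi :: "(real \<Rightarrow> ennreal) \<Rightarrow> ereal" where
  "a_phi \<phi> = (SUP u \<in> {u. 0 \<le> u \<and> \<phi> u = 0}. ereal u)"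

definition orlicz_function :: "(real \<Rightarrow> ennreal) \<Rightarrow> bool" where
  "orlicz_function \<phi> \<longleftrightarrow>
     mono_on {0..} \<phi> \<and> \<phi> 0 = 0 \<and> continuous (at_right 0) \<phi> \<and>
     continuous_on {u. 0 < u \<and> ereal u < b_phi \<phi>} \<phi> \<and>
     (\<forall>b. b_phi \<phi> = ereal b \<longrightarrow> continuous (at_left b) \<phi>) \<and>
     (\<phi> \<longlongrightarrow> \<infinity>) at_top"

definition phi_inv :: "(real \<Rightarrow> ennreal) \<Rightarrow> real \<Rightarrow> real" where
  "phi_inv \<phi> v = Inf {u. 0 \<le> u \<and> \<phi> u > ennreal v}"

definition Delta_eps :: "(real \<Rightarrow> ennreal) \<Rightarrow> bool" where
  "Delta_eps \<phi> \<longleftrightarrow>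
     (\<forall>\<epsilon>\<in>{0<..<1}. \<exists>\<delta>\<in>{0<..<1}. \<forall>u\<ge>0. \<phi> (\<epsilon> * u) \<le> ennreal \<delta> * \<phi> u)"

definition Delta_eps_infinity :: "(real \<Rightarrow> ennreal) \<Rightarrow> bool" where
  "Delta_eps_infinity \<phi> \<longleftrightarrow>
     (\<forall>\<epsilon>\<in>{0<..<1}. \<exists>\<delta>\<in>{0<..<1}. \<exists>u0>0. \<forall>u\<ge>u0. \<phi> (\<epsilon> * u) \<le> ennreal \<delta> * \<phi> u)"

definition Delta_eps_zero :: "(real \<Rightarrow> ennreal) \<Rightarrow> bool" where
  "Delta_eps_zero \<phi> \<longleftrightarrow>
     (\<forall>\<epsilon>\<in>{0<..<1}. \<exists>\<delta>\<in>{0<..<1}. \<exists>u0>0. \<forall>u\<in>{0..u0}. \<phi> (\<epsilon> * u) \<le> ennreal \<delta> * \<phi> u)"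

definition alpha_all :: "(real \<Rightarrow> ennreal) \<Rightarrow> ereal" where
  "alpha_all \<phi> =
     (SUP p \<in> {p. \<exists>K\<ge>1. \<forall>u\<ge>0. \<forall>a\<in>{0<..1}. \<phi> (a * u) \<le> ennreal (K * a powr p) * \<phi> u}. ereal p)"

definition alpha_infinity :: "(real \<Rightarrow> ennreal) \<Rightarrow> ereal" where
  "alpha_infinity \<phi> =
     (SUP p \<in> {p. \<exists>K\<ge>1. \<exists>u0>0. \<phi> u0 < \<infinity> \<and>
        (\<forall>u\<ge>u0. \<forall>a\<in>{0<..1}. \<phi> (a * u) \<le> ennreal (K * a powr p) * \<phi> u)}. ereal p)"

definition alpha_zero :: "(real \<Rightarrow> ennreal) \<Rightarrow> ereal" where
  "alpha_zero \<phi> =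
     (SUP p \<in> {p. \<exists>K\<ge>1. \<exists>u0>0.
        \<forall>u\<in>{0..u0}. \<forall>a\<in>{0<..1}. \<phi> (a * u) \<le> ennreal (K * a powr p) * \<phi> u}. ereal p)"

text \<open>
  A relation because for \<open>E = L\<^sub>\<infinity>\<close> both \<open>alpha_infinity \<phi>\<close> and \<open>alpha_zero \<phi>\<close>
  (which may differ) are admitted as the index.
\<close>

definition is_alpha_E ::
  "'a measure \<Rightarrow> ('a \<Rightarrow> real) set \<Rightarrow> (real \<Rightarrow> ennreal) \<Rightarrow> ereal \<Rightarrow> bool" where
  "is_alpha_E M E \<phi> \<alpha> \<longleftrightarrow>
     (\<not> Linf M \<subseteq> E \<and> \<not> E \<subseteq> Linf M \<and> \<alpha> = alpha_all \<phi>) \<or>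
     (Linf M \<subseteq> E \<and> \<alpha> = alpha_infinity \<phi>) \<or>
     (E \<subseteq> Linf M \<and> \<alpha> = alpha_zero \<phi>)"


subsection \<open>The space \<open>E\<^sub>\<phi>\<close>\<close>

text \<open>
  \<open>\<phi>(|x|)\<close> takes values in \<open>[0,\<infinity>]\<close>; it belongs to \<open>E\<close> iff it is finite almost everywhere
  and its real version belongs to \<open>E\<close>.
\<close>

definition rho ::
  "'a measure \<Rightarrow> ('a \<Rightarrow> real) set \<Rightarrow> (('a \<Rightarrow> real) \<Rightarrow> real) \<Rightarrow> (real \<Rightarrow> ennreal)
     \<Rightarrow> ('a \<Rightarrow> real) \<Rightarrow> ennreal" where
  "rho M E N \<phi> x =
     (if (AE t in M. \<phi> \<bar>x t\<bar> < \<infinity>) \<and> (\<lambda>t. enn2real (\<phi> \<bar>x t\<bar>)) \<in> E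
      then ennreal (N (\<lambda>t. enn2real (\<phi> \<bar>x t\<bar>))) else \<infinity>)"

definition E_phi ::
  "'a measure \<Rightarrow> ('a \<Rightarrow> real) set \<Rightarrow> (('a \<Rightarrow> real) \<Rightarrow> real) \<Rightarrow> (real \<Rightarrow> ennreal)
     \<Rightarrow> ('a \<Rightarrow> real) set" where
  "E_phi M E N \<phi> =
     {x \<in> borel_measurable M. \<exists>l>0. rho M E N \<phi> (\<lambda>t. l * x t) < \<infinity>}"

text \<open>
  For a positive index \<open>\<alpha>\<close> in the sense of \<open>is_alpha_E\<close> and \<open>x \<in> E_phi M E N \<phi>\<close> the set
  below is nonempty, so the infimum in the reals is the intended one.
\<close>

definition norm_phi ::
  "'a measure \<Rightarrow> ('a \<Rightarrow> real) set \<Rightarrow> (('a \<Rightarrow> real) \<Rightarrow> real) \<Rightarrow> (real \<Rightarrow> ennreal)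
     \<Rightarrow> ('a \<Rightarrow> real) \<Rightarrow> real" where
  "norm_phi M E N \<phi> x = Inf {l. 0 < l \<and> rho M E N \<phi> (\<lambda>t. x t / l) \<le> 1}"

end

theory Submission
  imports Defs
begin

text \<open>
  A copy of \<open>l\<^sub>\<infinity>\<close> in \<open>E\<close> yields a function \<open>x \<ge> 0\<close> of norm at most one and disjoint sets \<open>A\<^sub>n\<close> on each of
  which \<open>x\<close> still has norm at least one (\<open>linf_copy_disjoint_blocks\<close>).  Let \<open>\<psi>\<close> be the generalised
  inverse of \<open>\<phi>\<close>.  Multiplying \<open>\<psi> \<circ> x\<close> by \<open>z\<^sub>n\<close> on \<open>A\<^sub>n\<close> is linear in \<open>z\<close> and compatible with absolute
  values.  It does not increase norms because \<open>\<phi> (\<psi> x) \<le> x\<close>.  It is isometric once stretching \<open>\<psi> \<circ> x\<close>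
  on \<open>A\<^sub>n\<close> by a factor \<open>l > 1\<close> pushes the modular above one, and this follows from a gain
  \<open>\<phi> (\<psi> x) \<le> \<delta> * \<phi> (l * \<psi> x)\<close> with \<open>\<delta> < 1\<close> on any part of \<open>A\<^sub>n\<close> on which \<open>x\<close> has norm at least one
  (\<open>linf_copy_criterion\<close>).  Where \<open>\<phi>\<close> is bounded on its domain of finiteness and \<open>x\<close> exceeds that bound,
  stretching makes \<open>\<phi>\<close> infinite, which is a gain as well.  It remains to find the gain.

  Under \<open>\<Delta>\<^sub>\<epsilon>\<close> on the whole half-line the gain is the growth condition itself.

  If \<open>E\<close> consists of bounded functions, completeness makes the norms of indicators of nonnull sets
  bounded away from zero, so \<open>a\<^sub>E > 0\<close> and \<open>x \<le> 1 / a\<^sub>E\<close>.  The growth condition handles the values near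
  zero.  On the remaining compact range strict monotonicity gives a gain at every point, and this gain
  is uniform (\<open>uniform_gain\<close>).

  If only growth at infinity is known, the small values of \<open>x\<close> are the obstacle, and \<open>E\<close> is
  rearrangement invariant over an interval and contains the constants.  Group the blocks into
  infinite unions \<open>B\<^sub>n\<close>.  Either \<open>x\<close> exceeds some \<open>c > 0\<close> on a subset of \<open>B\<^sub>n\<close> of infinite measure; then
  replacing \<open>x\<close> by \<open>max x c\<close> on \<open>B\<^sub>n\<close> keeps its distribution and hence its norm, and the values on \<open>B\<^sub>n\<close>
  become bounded below, where strict monotonicity and growth at infinity give a gain.  Or all the sets
  where \<open>x > c > 0\<close> have finite measure in \<open>B\<^sub>n\<close>; since \<open>E\<close> has nonzero order continuous elements,
  indicators of sets of small measure are small in norm, so far out in the sequence of blocks the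
  values of \<open>x\<close> below any given level contribute arbitrarily little, and the large values alone carry
  norm one on \<open>B\<^sub>n\<close> (\<open>norm_of_large_part\<close>).
\<close>

section \<open>Orlicz functions and their inverses\<close>

text \<open>
  The generalised inverse differs from \<open>phi_inv\<close> in taking the infimum over \<open>v \<le> \<phi> u\<close> instead of
  \<open>v < \<phi> u\<close>: it is the left continuous inverse, so it vanishes at \<open>0\<close> even if \<open>a > 0\<close>, and
  \<open>\<phi> (\<psi> v) \<le> v\<close> for every \<open>v \<ge> 0\<close>.
\<close>

definition orlicz_inverse :: "(real \<Rightarrow> ennreal) \<Rightarrow> real \<Rightarrow> real" where
  "orlicz_inverse \<phi> v = Inf {u. 0 \<le> u \<and> ennreal v \<le> \<phi> u}"

lemma ennreal_less_imp_le_scaled: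
  fixes a b :: ennreal
  assumes "a < b"
  shows "\<exists>e>0. e < 1 \<and> a \<le> ennreal e * b"
proof (cases b)
  case top
  then show ?thesis by (intro exI[of _ "1/2"]) (auto simp: ennreal_mult_top)
next
  case (real r)
  then obtain q where q: "a = ennreal q" "0 \<le> q" using assms by (cases a) auto
  have "q < r" using assms real q by (simp add: ennreal_less_iff)
  then show ?thesis using real q
    by (intro exI[of _ "(q / r + 1) / 2"]) 
       (auto simp: ennreal_mult[symmetric] field_simps add_pos_nonneg add_nonneg_pos)
qed

locale orlicz =
  fixes \<phi> :: "real \<Rightarrow> ennreal"
  assumes orlicz: "orlicz_function \<phi>"
    and a_less_b: "a_phi \<phi> < b_phi \<phi>"
begin

abbreviation \<psi> :: "real \<Rightarrow> real" where
  "\<psi> \<equiv> orlicz_inverse \<phi>"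

lemma phi_mono: "\<phi> u \<le> \<phi> v" if "0 \<le> u" "u \<le> v"
  using orlicz that unfolding orlicz_function_def by (auto elim!: mono_onD)

lemma phi_zero [simp]: "\<phi> 0 = 0"
  using orlicz unfolding orlicz_function_def by auto

lemma b_pos: "0 < b_phi \<phi>"
proof -
  have "ereal 0 \<le> a_phi \<phi>"
    unfolding a_phi_def by (rule SUP_upper) auto
  then show ?thesis using a_less_b by (simp add: zero_ereal_def)
qed

lemma a_le: "a_phi \<phi> \<le> ereal m" if "0 \<le> m" "\<phi> m \<noteq> 0"
  unfolding a_phi_def
proof (rule SUP_least, clarsimp)
  fix u assume "0 \<le> u" "\<phi> u = 0"
  show "u \<le> m"
    using phi_mono[of m u] that \<open>\<phi> u = 0\<close> by (cases "u \<le> m") auto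
qed

lemma phi_above_b: "\<phi> u = \<infinity>" if "b_phi \<phi> < ereal u"
proof (rule ccontr)
  assume "\<phi> u \<noteq> \<infinity>"
  moreover have "0 \<le> u"
    using b_pos that by (metis ereal_less(2) less_le_trans less_imp_le order.strict_trans)
  ultimately have "ereal u \<le> b_phi \<phi>"
    unfolding b_phi_def by (intro SUP_upper) (auto simp: less_top)
  with that show False by simp
qed

lemma phi_below_b: "\<phi> u < \<infinity>" if "0 \<le> u" and u: "ereal u < b_phi \<phi>"
proof -
  obtain v where v: "0 \<le> v" "\<phi> v < \<infinity>" "u < v"
    using u unfolding b_phi_def less_SUP_iff by auto
  then show ?thesis using phi_mono[of u v] that(1) by (auto intro: le_less_trans)
qed

lemma phi_unbounded: "\<exists>u\<ge>0. ennreal v < \<phi> u"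
proof -
  have "(\<phi> \<longlongrightarrow> \<infinity>) at_top" using orlicz unfolding orlicz_function_def by auto
  then have "eventually (\<lambda>u. ennreal v < \<phi> u) at_top"
    by (rule order_tendstoD) simp
  then have "eventually (\<lambda>u. 0 \<le> u \<and> ennreal v < \<phi> u) at_top"
    using eventually_ge_at_top[of 0] by eventually_elim auto
  then show ?thesis using eventually_happens'[OF trivial_limit_at_top_linorder] by blast
qed

lemma phi_left_continuous: "(\<phi> \<longlongrightarrow> \<phi> u) (at_left u)" if "0 < u" "ereal u \<le> b_phi \<phi>"
proof (cases "ereal u < b_phi \<phi>")
  case True
  have "continuous_on {u. 0 < u \<and> ereal u < b_phi \<phi>} \<phi>"
    using orlicz unfolding orlicz_function_def by auto
  moreover have "open {u. 0 < u \<and> ereal u < b_phi \<phi>}"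
    by (intro open_Collect_conj open_Collect_less continuous_intros)
  ultimately have "isCont \<phi> u" using True that by (auto simp: continuous_on_eq_continuous_at)
  then show ?thesis unfolding isCont_def by (rule filterlim_mono) (auto intro: at_le)
next
  case False
  then have "b_phi \<phi> = ereal u" using that by simp
  then have "continuous (at_left u) \<phi>" using orlicz unfolding orlicz_function_def by auto
  then show ?thesis by (simp add: continuous_within)
qed

lemma phi_right_continuous: "(\<phi> \<longlongrightarrow> \<phi> u) (at_right u)" if "0 \<le> u" "ereal u < b_phi \<phi>"
proof (cases "0 < u")
  case True
  have "continuous_on {u. 0 < u \<and> ereal u < b_phi \<phi>} \<phi>"
    using orlicz unfolding orlicz_function_def by auto
  moreover have "open {u. 0 < u \<and> ereal u < b_phi \<phi>}"
    by (intro open_Collect_conj open_Collect_less continuous_intros)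
  ultimately have "isCont \<phi> u" using True that by (auto simp: continuous_on_eq_continuous_at)
  then show ?thesis unfolding isCont_def by (rule filterlim_mono) (auto intro: at_le)
next
  case False
  then have "u = 0" using that by simp
  moreover have "continuous (at_right 0) \<phi>" using orlicz unfolding orlicz_function_def by auto
  ultimately show ?thesis by (simp add: continuous_within)
qed

lemma psi_set_nonempty: "{u. 0 \<le> u \<and> ennreal v \<le> \<phi> u} \<noteq> {}"
  using phi_unbounded[of v] by (auto intro: less_imp_le)

lemma psi_set_bdd: "bdd_below {u. 0 \<le> u \<and> ennreal v \<le> \<phi> u}"
  by (auto intro: bdd_belowI[of _ 0])

lemma psi_nonneg: "0 \<le> \<psi> v"
  unfolding orlicz_inverse_def by (rule cInf_greatest[OF psi_set_nonempty]) auto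

lemma psi_le: "\<psi> v \<le> u" if "0 \<le> u" "ennreal v \<le> \<phi> u"
  unfolding orlicz_inverse_def by (rule cInf_lower[OF _ psi_set_bdd]) (use that in auto)

lemma psi_mono: "mono \<psi>"
  unfolding orlicz_inverse_def
  by (intro monoI cInf_superset_mono psi_set_nonempty psi_set_bdd)
     (auto intro: order_trans ennreal_leI)

lemma phi_less_of_less_psi: "\<phi> u < ennreal v" if "0 \<le> u" "u < \<psi> v"
  using psi_le[of u v] that by (meson not_le)

lemma le_phi_of_psi_less: "ennreal v \<le> \<phi> u" if less: "\<psi> v < u"
proof -
  obtain w where "0 \<le> w" "ennreal v \<le> \<phi> w" "w < u"
    using cInf_lessD[OF psi_set_nonempty less[unfolded orlicz_inverse_def]] by auto
  then show ?thesis using phi_mono[of w u] by (auto intro: order_trans)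
qed

lemma psi_le_b: "ereal (\<psi> v) \<le> b_phi \<phi>"
proof (rule ccontr)
  assume "\<not> ereal (\<psi> v) \<le> b_phi \<phi>"
  then obtain w where w: "b_phi \<phi> < ereal w" "w < \<psi> v"
    by (metis ereal_dense2 ereal_less(3) less_ereal.simps(1) not_le)
  have "0 \<le> w" using b_pos w(1) by (metis ereal_less(2) less_imp_le order.strict_trans)
  then have "\<phi> w < ennreal v" using w by (intro phi_less_of_less_psi)
  then show False using phi_above_b[OF w(1)] by simp
qed

lemma phi_psi_le: "\<phi> (\<psi> v) \<le> ennreal v"
proof (cases "\<psi> v = 0")
  case False
  then have pos: "0 < \<psi> v" using psi_nonneg[of v] by simp
  have "eventually (\<lambda>u. u \<in> {0<..<\<psi> v}) (at_left (\<psi> v))"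
    using pos by (intro eventually_at_left_real)
  then have "eventually (\<lambda>u. \<phi> u \<le> ennreal v) (at_left (\<psi> v))"
    by eventually_elim (auto intro!: less_imp_le phi_less_of_less_psi)
  then show ?thesis
    by (rule tendsto_upperbound[OF phi_left_continuous[OF pos psi_le_b]]) simp
qed simp

text \<open>
  The equation \<open>\<phi> (\<psi> v) = v\<close> can fail only at values above a finite \<open>\<phi> b\<close>, where \<open>\<psi> v = b\<close>; there
  any dilation makes \<open>\<phi>\<close> infinite.
\<close>

lemma phi_psi_dichotomy:
  assumes "1 < l"
  shows "ennreal v \<le> \<phi> (\<psi> v) \<or> \<phi> (l * \<psi> v) = \<infinity>"
proof (cases "ereal (\<psi> v) < b_phi \<phi>")
  case True
  have "eventually (\<lambda>u. ennreal v \<le> \<phi> u) (at_right (\<psi> v))"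
    using eventually_at_right_less[of "\<psi> v"] by eventually_elim (rule le_phi_of_psi_less)
  then have "ennreal v \<le> \<phi> (\<psi> v)"
    by (rule tendsto_lowerbound[OF phi_right_continuous[OF psi_nonneg True]]) simp
  then show ?thesis ..
next
  case False
  then have "b_phi \<phi> = ereal (\<psi> v)" using psi_le_b[of v] by simp
  moreover then have "0 < \<psi> v" using b_pos by (simp add: zero_ereal_def)
  ultimately have "\<phi> (l * \<psi> v) = \<infinity>"
    using assms by (intro phi_above_b) simp
  then show ?thesis ..
qed

lemma psi_measurable: "\<psi> \<in> borel_measurable borel"
  by (rule borel_measurable_mono[OF psi_mono])

lemma phi_abs_measurable: "(\<lambda>u. \<phi> \<bar>u\<bar>) \<in> borel_measurable borel"
proof -
  have "(\<lambda>u. \<phi> (max 0 u)) \<in> borel_measurable borel"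
  proof (rule borel_measurableI_greater)
    fix a
    have "is_interval {u. a < \<phi> (max 0 u)}"
      unfolding is_interval_1 
    proof (clarsimp)
      fix u v w assume "a < \<phi> (max 0 u)" "u \<le> w"
      moreover have "\<phi> (max 0 u) \<le> \<phi> (max 0 w)"
        using \<open>u \<le> w\<close> by (intro phi_mono) auto
      ultimately show "a < \<phi> (max 0 w)" by simp
    qed
    then show "{u \<in> space borel. a < \<phi> (max 0 u)} \<in> sets borel"
      using real_interval_borel_measurable by simp
  qed
  then have "(\<lambda>u. \<phi> (max 0 \<bar>u\<bar>)) \<in> borel_measurable borel"
    by (rule measurable_compose[rotated]) simp
  then show ?thesis by simp
qed

text \<open>
  On a compact interval a pointwise strict gain is uniform: cover the interval by finitely many
  steps of ratio \<open>sqrt l\<close>, so that a further step of that ratio is still below \<open>l * u\<close>.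
\<close>

lemma uniform_gain:
  assumes "0 < p" "1 < l"
    and strict: "\<And>m g. p \<le> m \<Longrightarrow> m \<le> c \<Longrightarrow> 1 < g \<Longrightarrow> \<phi> m = 0 \<or> \<phi> m < \<phi> (g * m)"
  shows "\<exists>\<delta>\<in>{0<..<1}. \<forall>u\<in>{p..c}. \<phi> u \<le> ennreal \<delta> * \<phi> (l * u)"
proof -
  define s where "s = sqrt l"
  have s: "1 < s" "s * s = l" using assms(2) by (auto simp: s_def)
  have "\<exists>\<delta>\<in>{0<..<1}. \<forall>u. p \<le> u \<and> u \<le> c \<and> u < p * s ^ k \<longrightarrow> \<phi> u \<le> ennreal \<delta> * \<phi> (l * u)" for k
  proof (induction k)
    case (Suc k)
    then obtain d where d: "0 < d" "d < 1"
      "\<And>u. p \<le> u \<Longrightarrow> u \<le> c \<Longrightarrow> u < p * s ^ k \<Longrightarrow> \<phi> u \<le> ennreal d * \<phi> (l * u)" by auto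
    define m where "m = min c (p * s ^ Suc k)"
    show ?case
    proof (cases "p \<le> m")
      case False
      then show ?thesis using d(1,2) by (intro bexI[of _ d]) (auto simp: m_def)
    next
      case True
      obtain e where e: "0 < e" "e < 1" "\<phi> m \<le> ennreal e * \<phi> (s * m)"
      proof (cases "\<phi> m = 0")
        case True
        then show ?thesis by (intro that[of "1/2"]) auto
      next
        case False
        then have "\<phi> m < \<phi> (s * m)" using strict[OF \<open>p \<le> m\<close> _ s(1)] by (auto simp: m_def)
        then show ?thesis using ennreal_less_imp_le_scaled that by blast
      qed
      have "\<phi> u \<le> ennreal (max d e) * \<phi> (l * u)" if u: "p \<le> u" "u \<le> c" "u < p * s ^ Suc k" for u
      proof (cases "u < p * s ^ k")
        case True
        have "\<phi> u \<le> ennreal d * \<phi> (l * u)" using d(3) u True by blast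
        also have "\<dots> \<le> ennreal (max d e) * \<phi> (l * u)"
          by (intro mult_right_mono ennreal_leI) auto
        finally show ?thesis .
      next
        case False
        have "m \<le> p * s ^ Suc k" by (simp add: m_def)
        also have "\<dots> = s * (p * s ^ k)" by simp
        also have "\<dots> \<le> s * u" using False s(1) by (intro mult_left_mono) auto
        finally have "s * m \<le> s * (s * u)" using s(1) by (intro mult_left_mono) auto
        then have sm: "s * m \<le> l * u" using s by (simp add: mult.assoc[symmetric])
        have "\<phi> u \<le> \<phi> m" using u assms(1) by (intro phi_mono) (auto simp: m_def)
        also have "\<dots> \<le> ennreal e * \<phi> (s * m)" by (rule e(3))
        also have "\<dots> \<le> ennreal (max d e) * \<phi> (l * u)"
          using s \<open>p \<le> m\<close> assms(1) by (intro mult_mono[OF ennreal_leI phi_mono[OF _ sm]]) auto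
        finally show ?thesis .
      qed
      then show ?thesis using d(1,2) e(1,2) by (intro bexI[of _ "max d e"]) auto
    qed
  qed (auto intro!: bexI[of _ "1/2"])
  moreover obtain k where "c / p < s ^ k" using real_arch_pow[OF s(1)] by blast
  then have "c < p * s ^ k" using assms(1) by (simp add: field_simps)
  ultimately show ?thesis by (smt (verit) atLeastAtMost_iff)
qed

text \<open>
  The point \<open>m\<close> may be the endpoint \<open>a\<close>, which lies outside the interval of strict monotonicity;
  two points strictly between \<open>m\<close> and \<open>g * m\<close> are compared instead.
\<close>

lemma strict_gain:
  assumes mono: "strict_mono_on {u. a_phi \<phi> < ereal u \<and> ereal u < Q} \<phi>"
    and m: "0 < m" "ereal m < Q" "1 < g" "\<phi> m \<noteq> 0"
  shows "\<phi> m < \<phi> (g * m)"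
proof -
  have gm: "m < g * m" using m by simp
  have "ereal m < min Q (ereal (g * m))" using m gm by simp
  then obtain v where v: "ereal m < ereal v" "ereal v < min Q (ereal (g * m))"
    using ereal_dense2 by blast
  then obtain u where u: "ereal m < ereal u" "ereal u < ereal v"
    using ereal_dense2 by blast
  have a: "a_phi \<phi> \<le> ereal m" using a_le m by auto
  have "\<phi> m \<le> \<phi> u" using u m by (intro phi_mono) auto
  also have "\<dots> < \<phi> v"
    proof (rule strict_mono_onD[OF mono])
    have "ereal v < Q" "a_phi \<phi> < ereal u" using a u v by (auto intro: le_less_trans)
    moreover have "ereal u < Q" using u(2) \<open>ereal v < Q\<close> by (rule less_trans)
    ultimately show "u \<in> {u. a_phi \<phi> < ereal u \<and> ereal u < Q}" 
      "v \<in> {u. a_phi \<phi> < ereal u \<and> ereal u < Q}"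
      using u by (auto intro: less_trans)
  qed (use u in simp)
  also have "\<dots> \<le> \<phi> (g * m)" using u v m by (intro phi_mono) auto
  finally show ?thesis .
qed

text \<open>
  A gain with factor \<open>\<delta> < 1\<close> at \<open>u\<close> is the inequality \<open>\<phi> u \<le> \<delta> * \<phi> (l * u)\<close>; it makes the modular
  leave the unit ball as soon as an element of modular one is stretched by \<open>l > 1\<close>.  The following
  lemmas provide such gains at the points \<open>u = \<psi> v\<close>, for the ranges of \<open>v\<close> that matter under each
  growth condition.
\<close>

lemma gain_of_Delta_eps:
  assumes "Delta_eps \<phi>" "1 < l"
  shows "\<exists>\<delta>\<in>{0<..<1}. \<forall>u\<ge>0. \<phi> u \<le> ennreal \<delta> * \<phi> (l * u)"
proof -
  obtain d where d: "0 < d" "d < 1" "\<And>u. 0 \<le> u \<Longrightarrow> \<phi> (1 / l * u) \<le> ennreal d * \<phi> u"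
    using assms unfolding Delta_eps_def by (metis divide_less_eq_1_pos greaterThanLessThan_iff
        less_trans zero_less_divide_1_iff zero_less_one)
  have "\<phi> u \<le> ennreal d * \<phi> (l * u)" if "0 \<le> u" for u
    using d(3)[of "l * u"] that assms(2) by simp
  then show ?thesis using d(1,2) by (intro bexI[of _ d]) auto
qed

text \<open>
  A threshold with \<open>\<phi> w < \<infinity>\<close> is needed in order to be exceeded by \<open>\<psi> v\<close> for large \<open>v\<close>.  If \<open>b\<close> is
  finite, any \<open>w \<in> (b / l, b)\<close> is one.
\<close>

lemma gain_of_Delta_eps_infinity:
  assumes "Delta_eps_infinity \<phi>" "1 < l"
  obtains \<delta> w where "0 < \<delta>" "\<delta> < 1" "0 < w" "\<phi> w < \<infinity>" 
    "\<And>u. w \<le> u \<Longrightarrow> \<phi> u \<le> ennreal \<delta> * \<phi> (l * u)"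
proof (cases "b_phi \<phi>")
  case (real b)
  have b: "0 < b" using b_pos real by (simp add: zero_ereal_def)
  define w where "w = (b / l + b) / 2"
  have w: "b / l < w" "w < b" using b assms(2) by (auto simp: w_def field_simps)
  show ?thesis
  proof (rule that[of "1/2" w])
    show "0 < w" using w(1) b assms(2) by (smt (verit) divide_pos_pos)
    then show "\<phi> w < \<infinity>" using w real by (intro phi_below_b) auto
    fix u assume "w \<le> u"
    then have "b < l * u" using w assms(2) by (simp add: field_simps) (smt (verit) mult_left_mono)
    then have "\<phi> (l * u) = \<infinity>" using real by (intro phi_above_b) auto
    then show "\<phi> u \<le> ennreal (1/2) * \<phi> (l * u)" by (simp add: ennreal_mult_top)
  qed auto
next
  case PInf
  have "1 / l \<in> {0<..<1}" using assms(2) by auto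
  then obtain d u0 where d: "0 < d" "d < 1" "0 < u0" "\<And>u. u0 \<le> u \<Longrightarrow> \<phi> (1 / l * u) \<le> ennreal d * \<phi> u"
    using assms unfolding Delta_eps_infinity_def by (metis greaterThanLessThan_iff)
  show ?thesis
  proof (rule that[of d "u0 / l"])
    show "\<phi> (u0 / l) < \<infinity>" using PInf d(3) assms(2) by (intro phi_below_b) auto
    show "\<phi> u \<le> ennreal d * \<phi> (l * u)" if "u0 / l \<le> u" for u
      using d(4)[of "l * u"] that assms(2) by (simp add: field_simps)
  qed (use d assms in auto)
next
  case MInf
  then show ?thesis using b_pos by simp
qed

lemma gain_at_large_values:
  assumes "Delta_eps_infinity \<phi>" "1 < l"
  shows "\<exists>K\<ge>0. \<exists>\<delta>\<in>{0<..<1}. \<forall>v>K. \<phi> (\<psi> v) \<le> ennreal \<delta> * \<phi> (l * \<psi> v)"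
proof -
  obtain d w where d: "0 < d" "d < 1" "0 < w" "\<phi> w < \<infinity>" 
    "\<And>u. w \<le> u \<Longrightarrow> \<phi> u \<le> ennreal d * \<phi> (l * u)"
    using gain_of_Delta_eps_infinity[OF assms] by blast
  obtain K where K: "0 \<le> K" "\<phi> w = ennreal K" using d(4) by (cases "\<phi> w") auto
  have "\<phi> (\<psi> v) \<le> ennreal d * \<phi> (l * \<psi> v)" if "K < v" for v
  proof (rule d(5), rule ccontr)
    assume "\<not> w \<le> \<psi> v"
    then have "ennreal v \<le> ennreal K" using le_phi_of_psi_less[of v w] K by auto
    then show False using that K by simp
  qed
  then show ?thesis using d(1,2) K(1) by (intro exI[of _ K] conjI bexI[of _ d]) auto
qed

lemma psi_pos: "0 < \<psi> c" if "0 < c"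
proof (rule ccontr)
  assume "\<not> 0 < \<psi> c"
  then have "\<psi> c = 0" using psi_nonneg[of c] by simp
  then show False using phi_psi_dichotomy[of 2 c] that by auto
qed

text \<open>
  Growth at infinity covers the points \<open>u \<ge> w\<close> for some \<open>w\<close>, and on the compact interval from
  \<open>\<psi> c > a\<close> to \<open>w\<close> strict monotonicity gives a uniform gain.
\<close>

lemma gain_at_values_bounded_below:
  assumes "Delta_eps_infinity \<phi>" "1 < l" "0 < c"
    and mono: "strict_mono_on {u. a_phi \<phi> < ereal u \<and> ereal u < b_phi \<phi>} \<phi>"
  shows "\<exists>\<delta>\<in>{0<..<1}. \<forall>v\<ge>c. \<phi> (\<psi> v) \<le> ennreal \<delta> * \<phi> (l * \<psi> v)"
proof -
  obtain d w where d: "0 < d" "d < 1" "0 < w" "\<phi> w < \<infinity>" 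
    "\<And>u. w \<le> u \<Longrightarrow> \<phi> u \<le> ennreal d * \<phi> (l * u)"
    using gain_of_Delta_eps_infinity[OF assms(1,2)] by blast
  have "\<exists>\<delta>\<in>{0<..<1}. \<forall>u\<in>{\<psi> c..w}. \<phi> u \<le> ennreal \<delta> * \<phi> (l * u)"
  proof (rule uniform_gain[OF psi_pos assms(2)])
    fix m g :: real assume m: "\<psi> c \<le> m" "m \<le> w" "1 < g"
    have m0: "0 < m" using m psi_pos[OF assms(3)] by simp
    show "\<phi> m = 0 \<or> \<phi> m < \<phi> (g * m)"
    proof (cases "ereal m < b_phi \<phi>")
      case True
      then show ?thesis using strict_gain[OF mono m0 True m(3)] by blast
    next
      case False
      have "\<phi> m < \<infinity>" using phi_mono[of m w] m m0 d(4) by (auto intro: le_less_trans)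
      moreover have "b_phi \<phi> < ereal (g * m)"
        using False m0 m(3) by (auto simp: not_less intro: le_less_trans)
      ultimately show ?thesis using phi_above_b by simp
    qed
  qed fact
  then obtain e where e: "0 < e" "e < 1" "\<And>u. \<psi> c \<le> u \<Longrightarrow> u \<le> w \<Longrightarrow> \<phi> u \<le> ennreal e * \<phi> (l * u)"
    by auto
  have "\<phi> (\<psi> v) \<le> ennreal (max d e) * \<phi> (l * \<psi> v)" if "c \<le> v" for v
  proof -
    have "\<psi> c \<le> \<psi> v" using psi_mono that by (rule monoD)
    then have "\<phi> (\<psi> v) \<le> ennreal e * \<phi> (l * \<psi> v) \<or> \<phi> (\<psi> v) \<le> ennreal d * \<phi> (l * \<psi> v)"
      using d(5)[of "\<psi> v"] e(3)[of "\<psi> v"] by linarith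
    moreover have "ennreal e * \<phi> (l * \<psi> v) \<le> ennreal (max d e) * \<phi> (l * \<psi> v)"
      "ennreal d * \<phi> (l * \<psi> v) \<le> ennreal (max d e) * \<phi> (l * \<psi> v)"
      by (auto intro!: mult_right_mono ennreal_leI)
    ultimately show ?thesis by (auto intro: order_trans)
  qed
  then show ?thesis using d(1,2) e(1,2) by (intro bexI[of _ "max d e"]) auto
qed

text \<open>
  Growth at zero covers the points \<open>u \<le> u0 / l\<close>, and strict monotonicity covers the compact interval
  from there to \<open>\<psi> V\<close>.  At the right end of the interval of strict monotonicity the gain has
  another source: beyond \<open>b\<close> the function is infinite, and beyond \<open>phi_inv \<phi> V\<close> it exceeds
  \<open>V\<close>, whereas \<open>\<phi> (\<psi> V) \<le> V\<close>.
\<close>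

lemma gain_at_bounded_values:
  assumes "Delta_eps_zero \<phi>" "1 < l"
    and mono: "strict_mono_on {u. a_phi \<phi> < ereal u \<and>
          ereal u < min (ereal (phi_inv \<phi> V)) (b_phi \<phi>)} \<phi>"
  shows "\<exists>\<delta>\<in>{0<..<1}. \<forall>v\<le>V. \<phi> (\<psi> v) \<le> ennreal \<delta> * \<phi> (l * \<psi> v)"
proof -
  have "1 / l \<in> {0<..<1}" using assms(2) by auto
  then obtain d u0 where d: "0 < d" "d < 1" "0 < u0"
    "\<And>u. 0 \<le> u \<Longrightarrow> u \<le> u0 \<Longrightarrow> \<phi> (1 / l * u) \<le> ennreal d * \<phi> u"
    using assms(1) unfolding Delta_eps_zero_def
    by (metis atLeastAtMost_iff greaterThanLessThan_iff)
  have small: "\<phi> u \<le> ennreal d * \<phi> (l * u)" if "0 \<le> u" "u \<le> u0 / l" for u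
    using d(4)[of "l * u"] that assms(2) by (simp add: field_simps)
  have ne: "{u. 0 \<le> u \<and> ennreal V < \<phi> u} \<noteq> {}" using phi_unbounded[of V] by auto
  have psi_le_inv: "\<psi> V \<le> phi_inv \<phi> V"
    unfolding phi_inv_def by (rule cInf_greatest[OF ne]) (auto intro!: psi_le)
  have "\<exists>\<delta>\<in>{0<..<1}. \<forall>u\<in>{u0 / l..\<psi> V}. \<phi> u \<le> ennreal \<delta> * \<phi> (l * u)"
  proof (rule uniform_gain[OF _ assms(2)])
    show "0 < u0 / l" using d(3) assms(2) by simp
    fix m g :: real assume m: "u0 / l \<le> m" "m \<le> \<psi> V" "1 < g"
    have m0: "0 < m" using m d(3) assms(2) by (meson divide_pos_pos less_le_trans less_trans zero_less_one)
    have gm: "m < g * m" using m0 m(3) by simp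
    have le_V: "\<phi> m \<le> ennreal V"
      using phi_mono[of m "\<psi> V"] m m0 phi_psi_le[of V] by (auto intro: order_trans)
    consider "ereal m < min (ereal (phi_inv \<phi> V)) (b_phi \<phi>)" | "b_phi \<phi> \<le> ereal m" | "phi_inv \<phi> V \<le> m"
      unfolding min_less_iff_conj less_ereal.simps using not_le by metis
    then show "\<phi> m = 0 \<or> \<phi> m < \<phi> (g * m)"
    proof cases
      case 1
      then show ?thesis using strict_gain[OF mono m0 1 m(3)] by blast
    next
      case 2
      then have "\<phi> (g * m) = \<infinity>" using gm by (intro phi_above_b) (auto intro: le_less_trans)
      then show ?thesis using le_V by (auto simp: less_top intro: le_less_trans)
    next
      case 3
      then obtain u where u: "0 \<le> u" "ennreal V < \<phi> u" "u < g * m"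
        using cInf_lessD[OF ne, of "g * m"] gm unfolding phi_inv_def by auto
      then show ?thesis using phi_mono[of u "g * m"] le_V by auto
    qed
  qed
  then obtain e where e: "0 < e" "e < 1"
    "\<And>u. u0 / l \<le> u \<Longrightarrow> u \<le> \<psi> V \<Longrightarrow> \<phi> u \<le> ennreal e * \<phi> (l * u)" by auto
  have "\<phi> (\<psi> v) \<le> ennreal (max d e) * \<phi> (l * \<psi> v)" if "v \<le> V" for v
  proof -
    have "\<psi> v \<le> \<psi> V" using psi_mono that by (rule monoD)
    then have "\<phi> (\<psi> v) \<le> ennreal e * \<phi> (l * \<psi> v) \<or> \<phi> (\<psi> v) \<le> ennreal d * \<phi> (l * \<psi> v)"
      using small[of "\<psi> v"] e(3)[of "\<psi> v"] psi_nonneg[of v] by linarith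
    moreover have "ennreal e * \<phi> (l * \<psi> v) \<le> ennreal (max d e) * \<phi> (l * \<psi> v)"
      "ennreal d * \<phi> (l * \<psi> v) \<le> ennreal (max d e) * \<phi> (l * \<psi> v)"
      by (auto intro!: mult_right_mono ennreal_leI)
    ultimately show ?thesis by (auto intro: order_trans)
  qed
  then show ?thesis using d(1,2) e(1,2) by (intro bexI[of _ "max d e"]) auto
qed

end

section \<open>Disjoint blocks from a copy of $l_\infty$\<close>

locale quasi_Banach_ideal =
  fixes M :: "'a measure" and E :: "('a \<Rightarrow> real) set" and N :: "('a \<Rightarrow> real) \<Rightarrow> real"
  assumes quasi_Banach_ideal: "quasi_Banach_ideal_space M E N"
begin

lemma E_measurable: "x \<in> E \<Longrightarrow> x \<in> borel_measurable M"
  using quasi_Banach_ideal unfolding quasi_Banach_ideal_space_def L0_subspace_def by blast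

lemma E_zero: "(\<lambda>t. 0) \<in> E"
  and E_add: "x \<in> E \<Longrightarrow> y \<in> E \<Longrightarrow> (\<lambda>t. x t + y t) \<in> E"
  and E_scale: "x \<in> E \<Longrightarrow> (\<lambda>t. c * x t) \<in> E"
  using quasi_Banach_ideal unfolding quasi_Banach_ideal_space_def L0_subspace_def by blast+

lemma E_diff: "x \<in> E \<Longrightarrow> y \<in> E \<Longrightarrow> (\<lambda>t. x t - y t) \<in> E"
  using E_add[of x "\<lambda>t. -1 * y t"] E_scale[of y "-1"] by simp

lemma E_ideal: "x \<in> E" and N_le: "N x \<le> N y"
  if "x \<in> borel_measurable M" "y \<in> E" "AE t in M. \<bar>x t\<bar> \<le> \<bar>y t\<bar>"
  using quasi_Banach_ideal that unfolding quasi_Banach_ideal_space_def by blast+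

lemma N_nonneg: "x \<in> E \<Longrightarrow> 0 \<le> N x"
  and N_eq_zero_iff: "x \<in> E \<Longrightarrow> N x = 0 \<longleftrightarrow> (AE t in M. x t = 0)"
  and N_scale: "x \<in> E \<Longrightarrow> N (\<lambda>t. c * x t) = \<bar>c\<bar> * N x"
  using quasi_Banach_ideal
  unfolding quasi_Banach_ideal_space_def quasi_norm_on_def quasi_norm_const_def by blast+

text \<open>
  The images of the unit vectors are disjoint and dominated by the image \<open>x\<close> of the constant sequence
  \<open>1\<close>, because \<open>\<bar>P z\<bar> = P \<bar>z\<bar>\<close> turns \<open>\<bar>e\<^sub>n - e\<^sub>m\<bar> = e\<^sub>n + e\<^sub>m\<close> and \<open>\<bar>1 - e\<^sub>n\<bar> = 1 - e\<^sub>n\<close> into identities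
  between them.  Hence \<open>x\<close> has norm one on each of the sets where they are positive.
\<close>

lemma linf_copy_disjoint_blocks:
  assumes "contains_linf_copy M E N"
  obtains x A where "x \<in> E" "\<And>t. 0 \<le> x t" "N x \<le> 1"
    "\<And>n::nat. A n \<in> sets M" "disjoint_family A" "\<And>n. 1 \<le> N (\<lambda>t. indicator (A n) t * x t)"
proof -
  obtain P :: "(nat \<Rightarrow> real) \<Rightarrow> 'a \<Rightarrow> real" where
      P_E: "\<And>z. bounded (range z) \<Longrightarrow> P z \<in> E"
    and P_N: "\<And>z. bounded (range z) \<Longrightarrow> N (P z) = (SUP n. \<bar>z n\<bar>)"
    and P_abs: "\<And>z. bounded (range z) \<Longrightarrow> AE t in M. \<bar>P z t\<bar> = P (\<lambda>n. \<bar>z n\<bar>) t"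
    and P_lin: "\<And>z w c d. bounded (range z) \<Longrightarrow> bounded (range w) \<Longrightarrow>
      AE t in M. P (\<lambda>n. c * z n + d * w n) t = c * P z t + d * P w t"
    using assms unfolding contains_linf_copy_def by blast
  have bdd: "bounded (range z)" if "range z \<subseteq> {0, 1, -1}" for z :: "nat \<Rightarrow> real"
    using that by (rule bounded_subset[OF finite_imp_bounded, rotated]) simp
  define e :: "nat \<Rightarrow> nat \<Rightarrow> real" where "e n = (\<lambda>k. if k = n then 1 else 0)" for n
  define u :: "nat \<Rightarrow> real" where "u = (\<lambda>k. 1)"
  have b: "bounded (range (e n))" "bounded (range u)" for n
    using bdd[of "e n"] bdd[of u] unfolding e_def u_def by (simp_all add: image_subset_iff)
  have [measurable]: "P (e n) \<in> borel_measurable M" "P u \<in> borel_measurable M" for n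
    using P_E b E_measurable by auto
  have N_e: "N (P (e n)) = 1" for n
    unfolding P_N[OF b(1)] by (rule cSup_eq_maximum) (auto simp: e_def image_iff)
  have N_u: "N (P u) = 1" unfolding P_N[OF b(2)] by (simp add: u_def)
  have pos: "AE t in M. 0 \<le> P (e n) t" for n
  proof -
    have "(\<lambda>k. \<bar>e n k\<bar>) = e n" by (auto simp: e_def)
    then show ?thesis using P_abs[OF b(1), of n] by (auto elim!: eventually_mono)
  qed
  have disj: "AE t in M. n \<noteq> m \<longrightarrow> P (e n) t \<le> 0 \<or> P (e m) t \<le> 0" for n m
  proof (cases "n = m")
    case False
    define w where "w = (\<lambda>k. 1 * e n k + (-1) * e m k)"
    have "bounded (range w)" by (rule bdd) (use False in \<open>auto simp: w_def e_def split: if_splits\<close>)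
    note P_abs[OF this] P_lin[OF b(1) b(1), of 1 n "-1" m, folded w_def]
    moreover have "(\<lambda>k. \<bar>w k\<bar>) = (\<lambda>k. 1 * e n k + 1 * e m k)"
      using False by (auto simp: w_def e_def)
    ultimately show ?thesis
      using P_lin[OF b(1) b(1), of 1 n 1 m] by (auto elim!: eventually_elim2)
  qed simp
  have dom: "AE t in M. P (e n) t \<le> P u t" for n
  proof -
    define w where "w = (\<lambda>k. 1 * u k + (-1) * e n k)"
    have "bounded (range w)" by (rule bdd) (auto simp: w_def e_def u_def split: if_splits)
    note P_abs[OF this] P_lin[OF b(2) b(1), of 1 "-1" n, folded w_def]
    moreover have "(\<lambda>k. \<bar>w k\<bar>) = w" by (auto simp: w_def e_def u_def)
    ultimately show ?thesis by (auto elim!: eventually_elim2)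
  qed
  define x where "x t = \<bar>P u t\<bar>" for t
  \<comment> \<open>The smaller indices are excluded so that the sets are disjoint everywhere, not just almost
    everywhere.\<close>
  define A where "A n = {t \<in> space M. 0 < P (e n) t \<and> (\<forall>m<n. P (e m) t \<le> 0)}" for n
  have [measurable]: "x \<in> borel_measurable M" "A n \<in> sets M" for n
    unfolding x_def A_def by measurable
  have "x \<in> E" "N x \<le> N (P u)"
    using E_ideal[of x "P u"] N_le[of x "P u"] P_E[OF b(2)] by (auto simp: x_def)
  moreover have "disjoint_family A"
    unfolding disjoint_family_on_def A_def by (auto, metis linorder_neqE_nat not_le)
  moreover have "1 \<le> N (\<lambda>t. indicator (A n) t * x t)" for n
  proof -
    have "AE t in M. \<forall>m. n \<noteq> m \<longrightarrow> P (e n) t \<le> 0 \<or> P (e m) t \<le> 0"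
      using disj[of n] by (simp add: AE_all_countable)
    with pos[of n] dom[of n] AE_space have "AE t in M. \<bar>P (e n) t\<bar> \<le> \<bar>indicator (A n) t * x t\<bar>"
    proof eventually_elim
      case (elim t)
      show ?case
      proof (cases "P (e n) t = 0")
        case False
        then have "t \<in> A n" unfolding A_def using elim by force
        then show ?thesis using elim by (auto simp: x_def)
      qed simp
    qed
    moreover have "(\<lambda>t. indicator (A n) t * x t) \<in> E"
      by (rule E_ideal[OF _ \<open>x \<in> E\<close>]) (auto simp: indicator_def)
    ultimately have "N (P (e n)) \<le> N (\<lambda>t. indicator (A n) t * x t)" by (intro N_le) auto
    then show ?thesis using N_e by simp
  qed
  ultimately show ?thesis using N_u by (intro that[of x A]) (auto simp: x_def)
qed

end

section \<open>Transferring a copy of $l_\infty$ to the Orlicz space\<close>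

lemma Least_index_disjoint_family:
  fixes B :: "nat \<Rightarrow> 'a set"
  assumes "disjoint_family B" "t \<in> B n"
  shows "(LEAST n. t \<in> B n) = n"
proof (rule Least_equality)
  show "n \<le> m" if "t \<in> B m" for m
    using assms that by (cases "m = n") (auto simp: disjoint_family_on_def)
qed (rule assms)

locale orlicz_space = quasi_Banach_ideal M E N + orlicz \<phi>
  for M :: "'a measure" and E N \<phi>
begin

lemma phi_comp_measurable:
  assumes "w \<in> borel_measurable M"
  shows "(\<lambda>t. \<phi> \<bar>w t\<bar>) \<in> borel_measurable M"
  using measurable_compose[OF assms phi_abs_measurable] .

lemma rho_le_one:
  assumes x: "x \<in> E" "\<And>t. 0 \<le> x t" "N x \<le> 1"
    and w: "w \<in> borel_measurable M" "\<And>t. \<bar>w t\<bar> \<le> \<psi> (x t)"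
  shows "rho M E N \<phi> w \<le> 1"
proof -
  have le: "\<phi> \<bar>w t\<bar> \<le> ennreal (x t)" for t
    using phi_mono[OF _ w(2)[of t]] phi_psi_le[of "x t"] by (auto intro: order_trans)
  have fin: "\<phi> \<bar>w t\<bar> < \<infinity>" for t using le[of t] by (auto simp: less_top[symmetric] top_unique)
  have "enn2real (\<phi> \<bar>w t\<bar>) \<le> x t" for t
    using enn2real_mono[OF le[of t]] x(2)[of t] by simp
  moreover have "(\<lambda>t. enn2real (\<phi> \<bar>w t\<bar>)) \<in> borel_measurable M"
    using phi_comp_measurable[OF w(1)] by measurable
  ultimately have "(\<lambda>t. enn2real (\<phi> \<bar>w t\<bar>)) \<in> E" "N (\<lambda>t. enn2real (\<phi> \<bar>w t\<bar>)) \<le> N x"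
    using x by (auto intro!: E_ideal[OF _ x(1)] N_le[OF _ x(1)])
  then show ?thesis using fin x(3) unfolding rho_def by simp
qed

text \<open>
  If the modular of \<open>w\<close> were at most one, then \<open>\<phi> \<bar>w\<bar>\<close> would be finite almost everywhere, which
  excludes the values where \<open>\<phi> \<circ> \<psi>\<close> is cut off; on \<open>D\<close> this leaves \<open>x \<le> \<phi> (\<psi> x) \<le> \<delta> * \<phi> \<bar>w\<bar>\<close>,
  so \<open>x\<close> would have norm at most \<open>\<delta> < 1\<close> on \<open>D\<close>.
\<close>

lemma not_rho_le_one:
  assumes x: "x \<in> borel_measurable M" "\<And>t. 0 \<le> x t"
    and D: "D \<in> sets M" "1 \<le> N (\<lambda>t. indicator D t * x t)"
    and w: "\<And>t. t \<in> D \<Longrightarrow> l * \<psi> (x t) \<le> \<bar>w t\<bar>"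
    and l: "1 < l" and \<delta>: "0 < \<delta>" "\<delta> < 1"
    and gain: "AE t in M. t \<in> D \<longrightarrow> \<phi> (\<psi> (x t)) \<le> ennreal \<delta> * \<phi> (l * \<psi> (x t))"
  shows "\<not> rho M E N \<phi> w \<le> 1"
proof
  define v where "v t = enn2real (\<phi> \<bar>w t\<bar>)" for t
  assume "rho M E N \<phi> w \<le> 1"
  then have fin: "AE t in M. \<phi> \<bar>w t\<bar> < \<infinity>" and v: "v \<in> E" "N v \<le> 1"
    unfolding rho_def v_def by (auto split: if_splits simp: top_unique)
  have [measurable]: "D \<in> sets M" "x \<in> borel_measurable M" by fact+
  have "AE t in M. \<bar>indicator D t * x t\<bar> \<le> \<bar>\<delta> * v t\<bar>"
    using fin gain
  proof eventually_elim
    case (elim t)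
    show ?case
    proof (cases "t \<in> D")
      case True
      have le: "\<phi> (l * \<psi> (x t)) \<le> \<phi> \<bar>w t\<bar>"
        using w[OF True] l psi_nonneg[of "x t"] by (intro phi_mono) auto
      then have "\<phi> (l * \<psi> (x t)) \<noteq> \<infinity>" using elim(1) by (auto simp: top_unique)
      then have "ennreal (x t) \<le> \<phi> (\<psi> (x t))" using phi_psi_dichotomy[OF l] by blast
      also have "\<dots> \<le> ennreal \<delta> * \<phi> (l * \<psi> (x t))" using elim(2) True by blast
      also have "\<dots> \<le> ennreal \<delta> * \<phi> \<bar>w t\<bar>" using le by (intro mult_left_mono) auto
      also have "\<dots> = ennreal (\<delta> * v t)"
        using elim(1) \<delta> unfolding v_def by (simp add: ennreal_mult)
      finally show ?thesis using True x(2)[of t] \<delta> by (auto simp: v_def ennreal_le_iff)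
    qed simp
  qed
  then have "N (\<lambda>t. indicator D t * x t) \<le> N (\<lambda>t. \<delta> * v t)"
    using E_scale[OF v(1)] by (intro N_le) auto
  also have "\<dots> = \<delta> * N v" using N_scale[OF v(1)] \<delta> by simp
  also have "\<dots> \<le> \<delta>" using v(2) \<delta> by simp
  finally show False using D(2) \<delta> by simp
qed

text \<open>
  The copy multiplies \<open>\<psi> \<circ> x\<close> by \<open>z n\<close> on \<open>B n\<close>.  Its modular norm is at most the supremum of
  \<open>\<bar>z n\<bar>\<close> because \<open>\<phi> (\<psi> x) \<le> x\<close>, and at least \<open>\<bar>z n\<bar>\<close> because of the gain on a part \<open>D\<close> of \<open>B n\<close>
  that still carries the full norm of \<open>x\<close>.  The factor \<open>\<delta>\<close> and the part \<open>D\<close> may depend on \<open>n\<close>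
  and \<open>l\<close>.
\<close>

lemma linf_copy_criterion:
  assumes x: "x \<in> E" "\<And>t. 0 \<le> x t" "N x \<le> 1"
    and B: "\<And>n::nat. B n \<in> sets M" "disjoint_family B"
    and gain: "\<And>n l. 1 < l \<Longrightarrow> \<exists>\<delta>\<in>{0<..<1}. \<exists>D\<in>sets M. D \<subseteq> B n \<and>
      1 \<le> N (\<lambda>t. indicator D t * x t) \<and>
      (AE t in M. t \<in> D \<longrightarrow> \<phi> (\<psi> (x t)) \<le> ennreal \<delta> * \<phi> (l * \<psi> (x t)))"
  shows "contains_linf_copy M (E_phi M E N \<phi>) (norm_phi M E N \<phi>)"
proof -
  define idx where "idx t = (LEAST n. t \<in> B n)" for t
  \<comment> \<open>Outside the union the index is a default value, and the indicator removes it.\<close>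
  define P where "P z t = z (idx t) * (indicator (\<Union>n. B n) t * \<psi> (x t))" for z :: "nat \<Rightarrow> real" and t
  have [measurable]: "x \<in> borel_measurable M" "B n \<in> sets M" for n
    using x(1) B(1) E_measurable by auto
  note psi_measurable [measurable]
  have idx [measurable]: "idx \<in> measurable M (count_space UNIV)"
    unfolding idx_def by measurable
  have P_measurable [measurable]: "P z \<in> borel_measurable M" for z
    unfolding P_def by measurable
  note idx_eq = Least_index_disjoint_family[OF B(2), folded idx_def]
  have P_eq: "P z t = z n * \<psi> (x t)" if "t \<in> B n" for t n z
    using that idx_eq[OF that] unfolding P_def by (auto simp: indicator_def)
  have P_le: "\<bar>P z t\<bar> \<le> s * \<psi> (x t)" if "\<And>n. \<bar>z n\<bar> \<le> s" for z s t
  proof -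
    have "0 \<le> s" using that[of 0] by simp
    then show ?thesis
      using mult_right_mono[OF that[of "idx t"] psi_nonneg[of "x t"]] psi_nonneg[of "x t"]
      by (auto simp: P_def abs_mult indicator_def)
  qed
  have upper: "rho M E N \<phi> (\<lambda>t. P z t / l) \<le> 1" if "\<And>n. \<bar>z n\<bar> \<le> l" "0 < l" for z l
  proof (rule rho_le_one[OF x])
    show "\<bar>P z t / l\<bar> \<le> \<psi> (x t)" for t
      using P_le[of z l t] that by (simp add: field_simps)
  qed measurable
  have lower: "\<bar>z n\<bar> \<le> l" if "0 < l" "rho M E N \<phi> (\<lambda>t. P z t / l) \<le> 1" for z l n
  proof (rule ccontr)
    assume "\<not> \<bar>z n\<bar> \<le> l"
    then have l: "1 < \<bar>z n\<bar> / l" using that(1) by simp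
    obtain d D where d: "0 < d" "d < 1" and D: "D \<in> sets M" "D \<subseteq> B n"
      "1 \<le> N (\<lambda>t. indicator D t * x t)"
      "AE t in M. t \<in> D \<longrightarrow> \<phi> (\<psi> (x t)) \<le> ennreal d * \<phi> (\<bar>z n\<bar> / l * \<psi> (x t))"
      using gain[OF l, of n] by auto
    have "\<not> rho M E N \<phi> (\<lambda>t. P z t / l) \<le> 1"
    proof (rule not_rho_le_one[OF _ x(2) D(1,3) _ l d D(4)])
      show "\<bar>z n\<bar> / l * \<psi> (x t) \<le> \<bar>P z t / l\<bar>" if "t \<in> D" for t
        using P_eq[of t n z] that D(2) \<open>0 < l\<close> psi_nonneg[of "x t"] by (auto simp: abs_mult)
    qed measurable
    then show False using that(2) by blast
  qed
  have in_E_phi: "P z \<in> E_phi M E N \<phi>" and norm: "norm_phi M E N \<phi> (P z) = (SUP n. \<bar>z n\<bar>)"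
    if z: "bounded (range z)" for z
  proof -
    define s where "s = (SUP n. \<bar>z n\<bar>)"
    have bdd: "bdd_above (range (\<lambda>n. \<bar>z n\<bar>))"
      using z unfolding bounded_iff by (auto simp: bdd_above_def)
    have z_le: "\<bar>z n\<bar> \<le> s" for n unfolding s_def by (rule cSUP_upper[OF _ bdd]) simp
    have s: "0 \<le> s" using z_le[of 0] by simp
    have "\<bar>z n\<bar> \<le> s + 1" for n using z_le[of n] by simp
    then have "rho M E N \<phi> (\<lambda>t. P z t / (s + 1)) \<le> 1"
      using s by (intro upper) auto
    then have "rho M E N \<phi> (\<lambda>t. 1 / (s + 1) * P z t) < \<infinity>"
      by (auto intro: le_less_trans)
    then show "P z \<in> E_phi M E N \<phi>"
      using s unfolding E_phi_def by (auto intro!: exI[of _ "1 / (s + 1)"])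
    let ?L = "{l. 0 < l \<and> rho M E N \<phi> (\<lambda>t. P z t / l) \<le> 1}"
    have mem: "s + e \<in> ?L" if "0 < e" for e
    proof -
      have "\<bar>z n\<bar> \<le> s + e" for n using z_le[of n] that by simp
      then show ?thesis using s that by (auto intro: upper)
    qed
    have "s \<le> Inf ?L"
    proof (rule cInf_greatest)
      show "?L \<noteq> {}" using mem[of 1] by auto
      show "s \<le> l" if "l \<in> ?L" for l
        unfolding s_def using lower[of l z] that by (intro cSUP_least) auto
    qed
    moreover have "Inf ?L \<le> s"
    proof (rule field_le_epsilon)
      show "Inf ?L \<le> s + e" if "0 < e" for e
        using mem[OF that] by (intro cInf_lower) (auto intro: bdd_belowI[of _ 0])
    qed
    ultimately show "norm_phi M E N \<phi> (P z) = (SUP n. \<bar>z n\<bar>)"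
      unfolding norm_phi_def s_def by simp
  qed
  have abs: "\<bar>P z t\<bar> = P (\<lambda>n. \<bar>z n\<bar>) t" for z t
    using psi_nonneg[of "x t"] by (simp add: P_def abs_mult)
  have lin: "P (\<lambda>n. c * z n + d * w n) t = c * P z t + d * P w t" for z w c d t
    by (simp add: P_def algebra_simps)
  show ?thesis
    unfolding contains_linf_copy_def
    using in_E_phi norm abs lin by (intro exI[of _ P]) simp
qed

end

section \<open>Ideal spaces of bounded functions\<close>

lemma exists_large_on_positive_set:
  assumes "x \<in> borel_measurable M" "\<not> (AE t in M. x t \<le> (c::real))"
  obtains r where "c < r" "0 < emeasure M {t \<in> space M. r < x t}"
proof -
  have [measurable]: "x \<in> borel_measurable M" by fact
  have "\<exists>k::nat. \<not> (AE t in M. x t \<le> c + 1 / (real k + 1))"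
  proof (rule ccontr)
    assume "\<not> ?thesis"
    then have "AE t in M. \<forall>k::nat. x t \<le> c + 1 / (real k + 1)" by (simp add: AE_all_countable)
    then have "AE t in M. x t \<le> c"
    proof eventually_elim
      case (elim t)
      have "(\<lambda>k. c + 1 / (real k + 1)) \<longlonglongrightarrow> c + 0"
        using LIMSEQ_inverse_real_of_nat by (intro tendsto_intros) (simp add: field_simps)
      then show ?case using elim by (intro LIMSEQ_le_const[of _ c]) auto
    qed
    with assms(2) show False ..
  qed
  then obtain k :: nat where k: "\<not> (AE t in M. x t \<le> c + 1 / (real k + 1))" by blast
  have "emeasure M {t \<in> space M. c + 1 / (real k + 1) < x t} \<noteq> 0"
  proof
    assume "emeasure M {t \<in> space M. c + 1 / (real k + 1) < x t} = 0"
    then have "AE t in M. x t \<le> c + 1 / (real k + 1)"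
      by (subst AE_iff_null) (auto simp: not_le null_sets_def)
    with k show False ..
  qed
  then show ?thesis by (intro that[of "c + 1 / (real k + 1)"]) (auto simp: zero_less_iff_neq_zero)
qed

context quasi_Banach_ideal
begin

lemma E_sum: "finite K \<Longrightarrow> (\<And>k. k \<in> K \<Longrightarrow> y k \<in> E) \<Longrightarrow> (\<lambda>t. \<Sum>k\<in>K. y k t) \<in> E"
  by (induction K rule: finite_induct) (auto intro: E_zero E_add)

text \<open>
  With the quasi-norm constant \<open>C\<close> the decay rate \<open>1 / (2 * C)\<close> is what makes the partial sums a
  Cauchy sequence: summing from the right, each application of the triangle inequality costs a factor
  \<open>C\<close> and the rate regains it.  The limit dominates every term since the positive parts
  \<open>(y k - z)\<^sup>+\<close> lie below \<open>\<bar>S n - z\<bar>\<close> for \<open>n > k\<close>.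
\<close>

lemma upper_bound_of_small_sequence:
  fixes y :: "nat \<Rightarrow> 'a \<Rightarrow> real"
  assumes C: "1 \<le> C" "quasi_norm_const M E N C"
    and y: "\<And>k. y k \<in> E" "\<And>k t. 0 \<le> y k t" "\<And>k. N (y k) \<le> (1 / (2 * C)) ^ k"
  obtains z where "z \<in> E" "\<And>k. AE t in M. y k t \<le> z t"
proof -
  define q where "q = 1 / (2 * C)"
  have q: "0 < q" "q < 1" "C * q = 1 / 2" using C(1) by (auto simp: q_def field_simps)
  have triangle: "N (\<lambda>t. u t + v t) \<le> C * (N u + N v)" if "u \<in> E" "v \<in> E" for u v
    using C(2) that unfolding quasi_norm_const_def by blast
  have block: "N (\<lambda>t. \<Sum>k=m..<m+j. y k t) \<le> 2 * C * q ^ m" for m j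
  proof (induction j arbitrary: m)
    case 0
    have "N (\<lambda>t. 0) = 0" using N_eq_zero_iff[OF E_zero] by simp
    then show ?case using C(1) q by simp
  next
    case (Suc j)
    have "N (\<lambda>t. \<Sum>k=m..<m+Suc j. y k t) = N (\<lambda>t. y m t + (\<Sum>k=Suc m..<Suc m+j. y k t))"
      by (subst sum.atLeast_Suc_lessThan) simp_all
    also have "\<dots> \<le> C * (N (y m) + N (\<lambda>t. \<Sum>k=Suc m..<Suc m+j. y k t))"
      by (intro triangle y E_sum) auto
    also have "\<dots> \<le> C * (q ^ m + 2 * C * q ^ Suc m)"
      using y(3)[of m] Suc[of "Suc m"] C(1) by (intro mult_left_mono add_mono) (auto simp: q_def)
    also have "\<dots> = C * q ^ m + 2 * C * (C * q) * q ^ m" by (simp add: algebra_simps)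
    also have "\<dots> = 2 * C * q ^ m" unfolding q(3) by simp
    finally show ?case .
  qed
  define S where "S n t = (\<Sum>k<n. y k t)" for n t
  have S_E: "S n \<in> E" for n unfolding S_def by (intro E_sum y) auto
  have S_diff: "N (\<lambda>t. S n t - S m t) \<le> 2 * C * q ^ m" if "m \<le> n" for m n
  proof -
    have "S n t - S m t = (\<Sum>k=m..<m + (n - m). y k t)" for t
      using that unfolding S_def
      by (simp add: sum_diff_nat_ivl[of 0 m n, symmetric] lessThan_atLeast0)
    then show ?thesis using block[of m "n - m"] by simp
  qed
  have sym: "N (\<lambda>t. u t - v t) = N (\<lambda>t. v t - u t)" if "u \<in> E" "v \<in> E" for u v
    using N_scale[OF E_diff[OF that], of "-1"] by simp
  have "\<exists>k. \<forall>m\<ge>k. \<forall>n\<ge>k. N (\<lambda>t. S m t - S n t) < e" if e: "0 < e" for e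
  proof -
    obtain k where "q ^ k < e / (2 * C)"
      using real_arch_pow_inv[of "e / (2 * C)" q] e C(1) q by auto
    then have k: "2 * C * q ^ k < e" using C(1) by (simp add: field_simps)
    have "N (\<lambda>t. S m t - S n t) < e" if "k \<le> n" "n \<le> m" for m n
    proof -
      have "q ^ n \<le> q ^ k" using that q by (intro power_decreasing) auto
      then have "2 * C * q ^ n \<le> 2 * C * q ^ k" using C(1) by (intro mult_left_mono) auto
      then show ?thesis using S_diff[OF that(2)] k by linarith
    qed
    note ordered = this
    have "N (\<lambda>t. S m t - S n t) < e" if "k \<le> m" "k \<le> n" for m n
    proof (cases "n \<le> m")
      case True
      then show ?thesis using ordered that by blast
    next
      case False
      then show ?thesis using ordered[of m n] that unfolding sym[OF S_E S_E, of m n] by simp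
    qed
    then show ?thesis by blast
  qed
  then obtain z where z: "z \<in> E" "(\<lambda>n. N (\<lambda>t. S n t - z t)) \<longlonglongrightarrow> 0"
    using S_E quasi_Banach_ideal unfolding quasi_Banach_ideal_space_def complete_on_def by blast
  have "AE t in M. y k t \<le> z t" for k
  proof -
    define w where "w t = max 0 (y k t - z t)" for t
    have [measurable]: "y k \<in> borel_measurable M" "z \<in> borel_measurable M"
      using y(1) z(1) E_measurable by auto
    have w_meas: "w \<in> borel_measurable M" unfolding w_def by measurable
    have w: "w \<in> E" by (rule E_ideal[OF w_meas E_diff[OF y(1)[of k] z(1)]]) (auto simp: w_def)
    have le: "N w \<le> N (\<lambda>t. S n t - z t)" if "k < n" for n
    proof (rule N_le[OF w_meas E_diff[OF S_E z(1)]], rule AE_I2)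
      fix t
      have "y k t \<le> S n t" unfolding S_def using that y(2) by (intro member_le_sum) auto
      then show "\<bar>w t\<bar> \<le> \<bar>S n t - z t\<bar>" by (auto simp: w_def)
    qed
    have "N w \<le> 0"
      by (rule LIMSEQ_le_const[OF z(2)]) (use le in \<open>auto intro!: exI[of _ "Suc k"]\<close>)
    then have "AE t in M. w t = 0" using N_nonneg[OF w] N_eq_zero_iff[OF w] by simp
    then show ?thesis by eventually_elim (auto simp: w_def)
  qed
  then show ?thesis using z(1) that by blast
qed

text \<open>
  Sets of positive measure with rapidly decreasing indicator norms would admit, by completeness, a
  common upper bound in \<open>E\<close> of the functions \<open>k * indicator (A k)\<close>, and this bound is not essentially
  bounded.
\<close>

lemma indicator_norms_bounded_below:
  assumes "E \<subseteq> Linf M"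
  shows "\<exists>c>0. \<forall>A. A \<in> sets M \<longrightarrow> indicator A \<in> E \<longrightarrow> emeasure M A > 0 \<longrightarrow> c \<le> N (indicator A)"
proof (rule ccontr)
  assume neg: "\<not> ?thesis"
  obtain C where C: "1 \<le> C" "quasi_norm_const M E N C"
    using quasi_Banach_ideal unfolding quasi_Banach_ideal_space_def quasi_norm_on_def by blast
  define r where "r k = (1 / (2 * C)) ^ k / (real k + 1)" for k
  have "0 < r k" for k using C(1) by (simp add: r_def)
  then have "\<exists>A. A \<in> sets M \<and> indicator A \<in> E \<and> emeasure M A > 0 \<and> N (indicator A) < r k" for k
    using neg by (force simp: not_le)
  then obtain A where A: "\<And>k. A k \<in> sets M" "\<And>k. indicator (A k) \<in> E" "\<And>k. emeasure M (A k) > 0"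
    "\<And>k. N (indicator (A k)) < r k" by metis
  have small: "N (\<lambda>t. real k * indicator (A k) t) \<le> (1 / (2 * C)) ^ k" for k
  proof -
    have "N (\<lambda>t. real k * indicator (A k) t) \<le> (real k + 1) * r k"
      using A(4)[of k] N_nonneg[OF A(2)[of k]] unfolding N_scale[OF A(2)]
      by (intro mult_mono) auto
    then show ?thesis by (simp add: r_def)
  qed
  obtain z where z: "z \<in> E" "\<And>k. AE t in M. real k * indicator (A k) t \<le> z t"
    by (rule upper_bound_of_small_sequence[OF C, of "\<lambda>k t. real k * indicator (A k) t"])
       (use A(2) E_scale small in auto)
  obtain c where c: "AE t in M. \<bar>z t\<bar> \<le> c" using z(1) assms unfolding Linf_def by blast
  obtain k where k: "c < real k" using reals_Archimedean2 by blast
  have "AE t in M. t \<notin> A k" using z(2)[of k] c by eventually_elim (use k in auto)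
  then have "emeasure M (A k) = 0"
    using A(1)[of k] AE_iff_null_sets by (metis null_setsD1)
  then show False using A(3)[of k] by simp
qed

lemma indicator_in_E:
  assumes "x \<in> E" "A \<in> sets M" "0 < r" "\<And>t. t \<in> A \<Longrightarrow> r \<le> \<bar>x t\<bar>"
  shows "indicator A \<in> E" "r * N (indicator A) \<le> N x"
proof -
  have "AE t in M. \<bar>indicator A t\<bar> \<le> \<bar>1 / r * x t\<bar>"
    using assms(3,4) by (auto simp: indicator_def abs_mult field_simps)
  then show A: "indicator A \<in> E" using assms by (intro E_ideal[OF _ E_scale[OF assms(1), of "1 / r"]]) auto
  have "AE t in M. \<bar>r * indicator A t\<bar> \<le> \<bar>x t\<bar>"
    using assms(3,4) by (auto simp: indicator_def)
  then have "N (\<lambda>t. r * indicator A t) \<le> N x"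
    using assms by (intro N_le) auto
  then show "r * N (indicator A) \<le> N x" using N_scale[OF A, of r] assms(3) by simp
qed

lemma a_const_le: 
  assumes "A \<in> sets M" "indicator A \<in> E" "emeasure M A > 0"
  shows "a_const M E N \<le> N (indicator A)"
  unfolding a_const_def 
proof (rule cInf_lower)
  show "bdd_below {N (indicator A) |A. A \<in> sets M \<and> indicator A \<in> E \<and> emeasure M A > 0}"
    using N_nonneg by (auto intro!: bdd_belowI[of _ 0])
qed (use assms in auto)

lemma a_const_pos:
  assumes "emeasure M (space M) > 0" "E \<subseteq> Linf M"
  shows "0 < a_const M E N"
proof -
  obtain x where x: "x \<in> E" "AE t in M. 0 < x t"
    using quasi_Banach_ideal unfolding quasi_Banach_ideal_space_def by blast
  have "\<not> (AE t in M. x t \<le> 0)"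
  proof
    assume "AE t in M. x t \<le> 0"
    with x(2) have "AE t in M. False" by eventually_elim simp
    with assms(1) show False by (simp add: AE_iff_null null_sets_def)
  qed
  then obtain r where r: "0 < r" "0 < emeasure M {t \<in> space M. r < x t}"
    using exists_large_on_positive_set[OF E_measurable[OF x(1)]] by blast
  let ?A = "{t \<in> space M. r < x t}"
  have [measurable]: "x \<in> borel_measurable M" by (rule E_measurable[OF x(1)])
  have A: "?A \<in> sets M" by measurable
  have "indicator ?A \<in> E" by (rule indicator_in_E[OF x(1) A r(1)]) auto
  then have ne: "{N (indicator A) |A. A \<in> sets M \<and> indicator A \<in> E \<and> emeasure M A > 0} \<noteq> {}"
    using r(2) A by blast
  obtain c where c: "0 < c"
    "\<And>A. A \<in> sets M \<Longrightarrow> indicator A \<in> E \<Longrightarrow> emeasure M A > 0 \<Longrightarrow> c \<le> N (indicator A)"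
    using indicator_norms_bounded_below[OF assms(2)] by blast
  have "c \<le> a_const M E N"
    unfolding a_const_def by (rule cInf_greatest[OF ne]) (use c(2) in auto)
  with c(1) show ?thesis by simp
qed

lemma unit_ball_bounded_by_a_const:
  assumes pos: "0 < a_const M E N" and x: "x \<in> E" "N x \<le> 1"
  shows "AE t in M. x t \<le> 1 / a_const M E N"
proof (rule ccontr)
  have [measurable]: "x \<in> borel_measurable M" by (rule E_measurable[OF x(1)])
  assume "\<not> ?thesis"
  then obtain r where r: "1 / a_const M E N < r" "0 < emeasure M {t \<in> space M. r < x t}"
    using exists_large_on_positive_set[OF E_measurable[OF x(1)]] by blast
  let ?A = "{t \<in> space M. r < x t}"
  have r0: "0 < r" using r(1) pos by (meson less_trans zero_less_divide_1_iff)
  have A: "?A \<in> sets M" by measurable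
  have "r \<le> \<bar>x t\<bar>" if "t \<in> ?A" for t using that by auto
  note ind = indicator_in_E[OF x(1) A r0 this]
  have "1 < r * a_const M E N" using r(1) pos by (simp add: field_simps)
  also have "\<dots> \<le> r * N (indicator ?A)"
    using a_const_le[OF A ind(1) r(2)] r0 by (intro mult_left_mono) auto
  finally show False using ind(2) x(2) by simp
qed

end

context orlicz_space
begin

lemma linf_copy_of_Delta_eps:
  assumes "contains_linf_copy M E N" "Delta_eps \<phi>"
  shows "contains_linf_copy M (E_phi M E N \<phi>) (norm_phi M E N \<phi>)"
proof -
  obtain x A where x: "x \<in> E" "\<And>t. 0 \<le> x t" "N x \<le> 1"
    and A: "\<And>n::nat. A n \<in> sets M" "disjoint_family A" "\<And>n. 1 \<le> N (\<lambda>t. indicator (A n) t * x t)"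
    by (rule linf_copy_disjoint_blocks[OF assms(1)]) blast
  show ?thesis
  proof (rule linf_copy_criterion[OF x A(1,2)])
    fix n :: nat and l :: real assume "1 < l"
    then obtain d where d: "d \<in> {0<..<1}" "\<And>u. 0 \<le> u \<Longrightarrow> \<phi> u \<le> ennreal d * \<phi> (l * u)"
      using gain_of_Delta_eps[OF assms(2)] by blast
    have "AE t in M. t \<in> A n \<longrightarrow> \<phi> (\<psi> (x t)) \<le> ennreal d * \<phi> (l * \<psi> (x t))"
      using d(2) psi_nonneg by simp
    then show "\<exists>\<delta>\<in>{0<..<1}. \<exists>D\<in>sets M. D \<subseteq> A n \<and> 1 \<le> N (\<lambda>t. indicator D t * x t) \<and>
      (AE t in M. t \<in> D \<longrightarrow> \<phi> (\<psi> (x t)) \<le> ennreal \<delta> * \<phi> (l * \<psi> (x t)))"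
      using d(1) A by blast
  qed
qed

text \<open>
  Since the unit ball of \<open>E\<close> is bounded by \<open>1 / a_const M E N\<close>, a gain at values up to this bound is
  enough.
\<close>

lemma linf_copy_of_Delta_eps_zero:
  assumes "contains_linf_copy M E N" "Delta_eps_zero \<phi>"
    and "emeasure M (space M) > 0" "E \<subseteq> Linf M"
    and mono: "strict_mono_on
             {u. a_phi \<phi> < ereal u \<and>
                 ereal u < min (ereal (phi_inv \<phi> (1 / a_const M E N))) (b_phi \<phi>)} \<phi>"
  shows "contains_linf_copy M (E_phi M E N \<phi>) (norm_phi M E N \<phi>)"
proof -
  obtain x A where x: "x \<in> E" "\<And>t. 0 \<le> x t" "N x \<le> 1"
    and A: "\<And>n::nat. A n \<in> sets M" "disjoint_family A" "\<And>n. 1 \<le> N (\<lambda>t. indicator (A n) t * x t)"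
    by (rule linf_copy_disjoint_blocks[OF assms(1)]) blast
  have bound: "AE t in M. x t \<le> 1 / a_const M E N"
    by (rule unit_ball_bounded_by_a_const[OF a_const_pos[OF assms(3,4)] x(1,3)])
  show ?thesis
  proof (rule linf_copy_criterion[OF x A(1,2)])
    fix n :: nat and l :: real assume "1 < l"
    then obtain d where d: "d \<in> {0<..<1}"
      "\<And>v. v \<le> 1 / a_const M E N \<Longrightarrow> \<phi> (\<psi> v) \<le> ennreal d * \<phi> (l * \<psi> v)"
      using gain_at_bounded_values[OF assms(2) _ mono] by blast
    have "AE t in M. t \<in> A n \<longrightarrow> \<phi> (\<psi> (x t)) \<le> ennreal d * \<phi> (l * \<psi> (x t))"
      using bound by eventually_elim (use d(2) in blast)
    then show "\<exists>\<delta>\<in>{0<..<1}. \<exists>D\<in>sets M. D \<subseteq> A n \<and> 1 \<le> N (\<lambda>t. indicator D t * x t) \<and>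
      (AE t in M. t \<in> D \<longrightarrow> \<phi> (\<psi> (x t)) \<le> ennreal \<delta> * \<phi> (l * \<psi> (x t)))"
      using d(1) A by blast
  qed
qed

end

section \<open>Rearrangement invariant spaces over an interval\<close>

text \<open>
  The slices are \<open>G \<inter> f -` {..r}\<close> for the relabelling \<open>f\<close>.  Their measure is a Lipschitz function of
  \<open>r\<close>, so by the intermediate value theorem they realise every measure between \<open>0\<close> and that of a
  given slice.
\<close>

lemma Lebesgue_slices:
  assumes leb: "is_Lebesgue_on M I" and I: "I \<in> sets lborel" "I \<subseteq> {0<..}" and G: "G \<in> sets M"
  obtains H :: "real \<Rightarrow> 'a set" where
    "\<And>r. H r \<in> sets M" "\<And>r. H r \<subseteq> G" "\<And>r s. r \<le> s \<Longrightarrow> H r \<subseteq> H s" "H 0 = {}"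
    "\<And>r. emeasure M (H r) < \<infinity>" "(\<Union>n::nat. H (real n)) = G"
    "continuous_on UNIV (\<lambda>r. measure M (H r))"
proof -
  obtain f where f: "bij_betw f (space M) I" "f \<in> measurable M (lebesgue_on I)"
    "distr M (lebesgue_on I) f = lebesgue_on I"
    using leb unfolding is_Lebesgue_on_def by blast
  have I_leb: "I \<in> sets lebesgue" using I(1) by simp
  define pre where "pre J = f -` (J \<inter> I) \<inter> space M" for J
  have pre: "pre J \<in> sets M" "emeasure M (pre J) = emeasure lborel (J \<inter> I)" if "J \<in> sets borel" for J
  proof -
    have JI: "J \<inter> I \<in> sets (lebesgue_on I)"
      using that I(1) I_leb by (auto simp: sets_restrict_space_iff)
    show "pre J \<in> sets M" unfolding pre_def using f(2) JI by (rule measurable_sets)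
    have "emeasure M (pre J) = emeasure (distr M (lebesgue_on I) f) (J \<inter> I)"
      unfolding pre_def using f(2) JI by (simp add: emeasure_distr)
    also have "\<dots> = emeasure lebesgue (J \<inter> I)"
      unfolding f(3) using I_leb by (simp add: emeasure_restrict_space)
    also have "\<dots> = emeasure lborel (J \<inter> I)"
      using that I(1) by simp
    finally show "emeasure M (pre J) = emeasure lborel (J \<inter> I)" .
  qed
  have fI: "f t \<in> I" if "t \<in> space M" for t using f(1) that by (auto simp: bij_betw_def)
  have G_space: "G \<subseteq> space M" using G by (rule sets.sets_into_space)
  define H where "H r = G \<inter> pre {..r}" for r :: real
  have H_sets: "H r \<in> sets M" for r unfolding H_def using G pre(1) by auto
  have H_eq: "H r = {t \<in> G. f t \<le> r}" for r
    unfolding H_def pre_def using G_space fI by auto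
  have H_mono: "H r \<subseteq> H s" if "r \<le> s" for r s unfolding H_eq using that by auto
  have H_fin: "emeasure M (H r) < \<infinity>" for r
  proof -
    have "emeasure M (H r) \<le> emeasure M (pre {..r})"
      unfolding H_def using pre(1)[of "{..r}"] by (intro emeasure_mono) auto
    also have "\<dots> = emeasure lborel ({..r} \<inter> I)" by (rule pre(2)) simp
    also have "\<dots> \<le> emeasure lborel {0..r}"
      using I by (intro emeasure_mono) auto
    also have "\<dots> < \<infinity>" by (simp add: emeasure_lborel_Icc_eq)
    finally show ?thesis .
  qed
  have step: "\<bar>measure M (H s) - measure M (H r)\<bar> \<le> s - r" if "r \<le> s" for r s
  proof -
    have "H s - H r \<subseteq> pre {r<..s}"
      unfolding H_eq pre_def using G_space fI by auto
    then have "emeasure M (H s - H r) \<le> emeasure M (pre {r<..s})"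
      using pre(1)[of "{r<..s}"] by (intro emeasure_mono) auto
    also have "\<dots> = emeasure lborel ({r<..s} \<inter> I)" by (rule pre(2)) simp
    also have "\<dots> \<le> emeasure lborel {r<..s}" using I by (intro emeasure_mono) auto
    also have "\<dots> = ennreal (s - r)" using that by simp
    finally have "measure M (H s - H r) \<le> s - r"
      using that unfolding measure_def by (simp add: enn2real_leI)
    moreover have "measure M (H s - H r) = measure M (H s) - measure M (H r)"
      using H_fin H_sets H_mono[OF that] by (intro measure_Diff) (auto simp: less_top)
    ultimately show ?thesis by (metis abs_of_nonneg measure_nonneg)
  qed
  have "(1::real)-lipschitz_on UNIV (\<lambda>r. measure M (H r))"
  proof (rule lipschitz_onI)
    show "dist (measure M (H r)) (measure M (H s)) \<le> 1 * dist r s" for r s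
      using step[of r s] step[of s r] by (cases "r \<le> s") (auto simp: dist_real_def)
  qed simp
  then have "continuous_on UNIV (\<lambda>r. measure M (H r))" by (rule lipschitz_on_continuous_on)
  moreover have "H 0 = {}" using I(2) fI G_space unfolding H_eq by force
  moreover have "(\<Union>n::nat. H (real n)) = G"
    unfolding H_eq using real_arch_simple by blast
  moreover have "H r \<subseteq> G" for r unfolding H_eq by blast
  ultimately show ?thesis using H_sets H_mono H_fin by (intro that[of H]) auto
qed

context quasi_Banach_ideal
begin

text \<open>
  The support of \<open>E\<close> is the whole space, as \<open>E\<close> has a strictly positive element.
\<close>

lemma order_cont_part_nontrivial:
  assumes "emeasure M (space M) > 0" "same_support M (order_cont_part M E N) E"
  obtains z where "z \<in> order_cont_part M E N" "\<not> (AE t in M. z t = 0)"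
proof (rule ccontr)
  assume "\<not> thesis"
  then have zero: "\<forall>z\<in>order_cont_part M E N. AE t in M. t \<notin> {} \<longrightarrow> z t = 0" using that by auto
  obtain S where S: "is_support M (order_cont_part M E N) S" "is_support M E S"
    using assms(2) unfolding same_support_def by blast
  obtain x where x: "x \<in> E" "AE t in M. 0 < x t"
    using quasi_Banach_ideal unfolding quasi_Banach_ideal_space_def by blast
  have "S - {} \<in> null_sets M" using S(1) zero unfolding is_support_def by blast
  then have "AE t in M. t \<notin> S" using AE_not_in by simp
  moreover have "AE t in M. t \<notin> S \<longrightarrow> x t = 0" using S(2) x(1) unfolding is_support_def by blast
  ultimately have "AE t in M. False" using x(2) by eventually_elim auto
  with assms(1) show False by (simp add: AE_iff_null null_sets_def)
qed

text \<open>
  A nonzero order continuous element is at least some \<open>s > 0\<close> on a set \<open>G\<close> of positive measure, hence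
  the indicators of slices of \<open>G\<close> that shrink to a null set tend to zero in norm.  By rearrangement
  invariance the norm of an indicator depends only on the measure, and every small measure is that of
  a slice.
\<close>

lemma indicator_norm_small:
  assumes ri: "ri_Banach_space M E N"
    and leb: "is_Lebesgue_on M I" and I: "I \<in> sets lborel" "I \<subseteq> {0<..}"
    and z: "z \<in> order_cont_part M E N" "\<not> (AE t in M. z t = 0)" and e: "0 < e"
  shows "\<exists>d>0. \<forall>A\<in>sets M. emeasure M A < ennreal d \<longrightarrow> indicator A \<in> E \<and> N (indicator A) < e"
proof -
  have zE: "z \<in> E" using z(1) unfolding order_cont_part_def by blast
  have [measurable]: "z \<in> borel_measurable M" by (rule E_measurable[OF zE])
  have "\<not> (AE t in M. \<bar>z t\<bar> \<le> 0)" using z(2) by simp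
  then obtain s where s: "0 < s" "0 < emeasure M {t \<in> space M. s < \<bar>z t\<bar>}"
    using exists_large_on_positive_set[where x = "\<lambda>t. \<bar>z t\<bar>" and c = 0 and M = M] by auto
  define G where "G = {t \<in> space M. s < \<bar>z t\<bar>}"
  have G: "G \<in> sets M" unfolding G_def by measurable
  obtain H :: "real \<Rightarrow> 'a set" where H [measurable]: "\<And>r. H r \<in> sets M"
    and H_G: "\<And>r. H r \<subseteq> G" and H_mono: "\<And>r s. r \<le> s \<Longrightarrow> H r \<subseteq> H s" and H0: "H 0 = {}"
    and H_fin: "\<And>r. emeasure M (H r) < \<infinity>" and H_UN: "(\<Union>n::nat. H (real n)) = G"
    and H_cont: "continuous_on UNIV (\<lambda>r. measure M (H r))"
    by (rule Lebesgue_slices[OF leb I G]) blast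
  define g where "g r = measure M (H r)" for r
  have g_emeasure: "emeasure M (H r) = ennreal (g r)" for r
    unfolding g_def using H_fin[of r] by (simp add: emeasure_eq_ennreal_measure)
  have slice: "\<exists>r\<ge>0. r \<le> R \<and> g r = v" if "0 \<le> v" "v \<le> g R" "0 \<le> R" for v R
    using IVT'[of g 0 v R] that H0 continuous_on_subset[OF H_cont]
    unfolding g_def by auto
  have "\<exists>R\<ge>0. 0 < g R"
  proof (rule ccontr)
    assume "\<not> ?thesis"
    then have "g (real n) = 0" for n :: nat
      using measure_nonneg[of M "H (real n)"] unfolding g_def by (metis less_eq_real_def of_nat_0_le_iff)
    then have "H (real n) \<in> null_sets M" for n :: nat
      using g_emeasure[of "real n"] H by (auto simp: null_sets_def)
    then have "G \<in> null_sets M" unfolding H_UN[symmetric] by (rule null_sets_UN)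
    then show False using s(2) unfolding G_def by (auto simp: null_sets_def)
  qed
  then obtain R where R: "0 \<le> R" "0 < g R" by blast
  have "\<exists>r. 0 \<le> r \<and> r \<le> R \<and> g r = g R / 2 ^ m" for m :: nat
  proof -
    have "g R / 2 ^ m \<le> g R / 1" using R(2) by (intro divide_left_mono) auto
    then show ?thesis using slice[of "g R / 2 ^ m" R] R by auto
  qed
  then obtain r where r: "\<And>m::nat. 0 \<le> r m" "\<And>m. g (r m) = g R / 2 ^ m" by metis
  have g_mono: "g a \<le> g b" if "a \<le> b" for a b
    unfolding g_def using H_mono[OF that] H_fin[of b] by (intro measure_mono_fmeasurable) (auto simp: fmeasurable_def)
  have r_Suc: "r (Suc m) \<le> r m" for m
  proof (rule ccontr)
    assume "\<not> ?thesis"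
    then have "g R / 2 ^ m \<le> g R / 2 ^ Suc m" using g_mono[of "r m" "r (Suc m)"] r(2) by simp
    then show False using R(2) by (simp add: field_simps)
  qed
  have r_decseq: "r n \<le> r m" if "m \<le> n" for m n
    using decseqD[OF decseq_SucI[of r] that] r_Suc by blast
  \<comment> \<open>The measures of the slices at \<open>r m\<close> are halved at each step, so the slices decrease to a null
    set.\<close>
  define X where "X m t = s * indicator (H (r m)) t" for m t
  have X_meas: "X m \<in> borel_measurable M" for m unfolding X_def by measurable
  have X_le: "0 \<le> X m t \<and> X m t \<le> \<bar>z t\<bar>" for m t
    using s(1) H_G[of "r m"] unfolding X_def G_def by (auto simp: indicator_def)
  have X_lim: "AE t in M. (\<lambda>m. X m t) \<longlonglongrightarrow> 0"
  proof -
    define Z where "Z = (\<Inter>m. H (r m))"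
    have Z: "Z \<in> sets M" unfolding Z_def by measurable
    have "emeasure M Z \<le> ennreal (g R / 2 ^ m)" for m
      using emeasure_mono[of Z "H (r m)" M] H unfolding g_emeasure r(2) Z_def by blast
    moreover have "(\<lambda>m. ennreal (g R / 2 ^ m)) \<longlonglongrightarrow> ennreal 0"
      by (intro tendsto_ennrealI LIMSEQ_divide_realpow_zero) simp
    ultimately have "emeasure M Z \<le> ennreal 0"
      by (intro LIMSEQ_le_const) auto
    then have "AE t in M. t \<notin> Z" using Z by (intro AE_not_in) (auto simp: null_sets_def)
    then show ?thesis
    proof eventually_elim
      case (elim t)
      then obtain m where m: "t \<notin> H (r m)" unfolding Z_def by blast
      have "eventually (\<lambda>n. X n t = 0) sequentially"
        using eventually_ge_at_top[of m]
      proof eventually_elim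
        case (elim n)
        then show ?case using m H_mono[OF r_decseq[OF elim]] unfolding X_def by (auto simp: indicator_def)
      qed
      then show ?case by (rule tendsto_eventually)
    qed
  qed
  have "(\<lambda>m. N (X m)) \<longlonglongrightarrow> 0"
    using z(1) X_meas X_le X_lim unfolding order_cont_part_def by auto
  then have "eventually (\<lambda>m. N (X m) < s * e) sequentially"
    using s(1) e by (intro order_tendstoD) auto
  then obtain m where m: "N (X m) < s * e" by (auto simp: eventually_sequentially)
  show ?thesis
  proof (intro exI[of _ "g (r m)"] conjI ballI impI)
    show "0 < g (r m)" using r(2) R(2) by simp
    fix A assume A: "A \<in> sets M" "emeasure M A < ennreal (g (r m))"
    then obtain v where v: "emeasure M A = ennreal v" "0 \<le> v" "v \<le> g (r m)"
      by (cases "emeasure M A") (auto simp: ennreal_less_iff)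
    obtain q where q: "0 \<le> q" "q \<le> r m" "g q = v" using slice[OF v(2,3) r(1)] by blast
    have "indicator (H q) \<in> E" 
      by (rule indicator_in_E[OF zE H s(1)]) (use H_G[of q] in \<open>auto simp: G_def\<close>)
    moreover have "equimeasurable M (indicator (H q)) (indicator A)"
    proof -
      have "{t \<in> space M. \<bar>indicat_real B t\<bar> > c} = (if c < 1 then B else {})"
        if "0 \<le> c" "B \<in> sets M" for c B
        using that sets.sets_into_space[of B M] by (auto simp: indicator_def)
      then show ?thesis unfolding equimeasurable_def using H A(1) g_emeasure[of q] v(1) q(3) by simp
    qed
    ultimately have A_E: "indicator A \<in> E" and A_N: "N (indicator A) = N (indicator (H q))"
      using ri A(1) unfolding ri_Banach_space_def by auto
    have "X m \<in> E" using X_meas X_le by (intro E_ideal[OF _ zE]) auto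
    then have "s * N (indicator (H q)) \<le> N (X m)"
      using s(1) H_mono[OF q(2)] by (intro indicator_in_E(2)) (auto simp: X_def)
    then have "s * N (indicator A) < s * e" using m A_N by simp
    then have "N (indicator A) < e" using s(1) by (simp add: mult_less_cancel_left_pos)
    with A_E show "indicator A \<in> E" "N (indicator A) < e" by auto
  qed
qed

text \<open>
  On \<open>A k\<close> the part of \<open>x\<close> below \<open>K\<close> is at most \<open>s + K * indicator (F k)\<close>, where \<open>F k\<close> is the part of \<open>A k\<close>
  on which \<open>x > s\<close>.  The disjoint sets \<open>F k\<close> have a union of finite measure, so their measures tend to
  zero; for small \<open>s\<close> and large \<open>k\<close> the part below \<open>K\<close> is therefore negligible in norm, and the part
  above \<open>K\<close> carries the norm of \<open>x\<close> on \<open>A k\<close>.  This is why the blocks must be grouped into infinite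
  unions.
\<close>

lemma norm_of_large_part:
  fixes A :: "nat \<Rightarrow> 'a set"
  assumes norm: "norm_on M E N" and one: "(\<lambda>t. 1) \<in> E"
    and small: "\<And>e. 0 < e \<Longrightarrow>
      \<exists>d>0. \<forall>A\<in>sets M. emeasure M A < ennreal d \<longrightarrow> indicator A \<in> E \<and> N (indicator A) < e"
    and x: "x \<in> E" "\<And>t. 0 \<le> x t"
    and A: "\<And>k. A k \<in> sets M" "disjoint_family A" "\<And>k. 1 \<le> N (\<lambda>t. indicator (A k) t * x t)"
    and fin: "\<And>c. 0 < c \<Longrightarrow> emeasure M ((\<Union>k. A k) \<inter> {t \<in> space M. c < x t}) < \<infinity>"
    and K: "0 \<le> K"
  shows "1 \<le> N (\<lambda>t. indicator ((\<Union>k. A k) \<inter> {t \<in> space M. K < x t}) t * x t)"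
proof (rule field_le_epsilon)
  fix e :: real assume e: "0 < e"
  have [measurable]: "x \<in> borel_measurable M" "\<And>k. A k \<in> sets M" by (rule E_measurable[OF x(1)], fact)
  have triangle: "N (\<lambda>t. u t + v t) \<le> N u + N v" if "u \<in> E" "v \<in> E" for u v
    using norm that unfolding norm_on_def quasi_norm_const_def by auto
  define s where "s = e / (2 * (N (\<lambda>t. 1) + 1))"
  have N1: "0 \<le> N (\<lambda>t. 1)" by (rule N_nonneg[OF one])
  have s: "0 < s" using e N1 by (simp add: s_def)
  have sN: "s * N (\<lambda>t. 1) \<le> e / 2"
  proof -
    have "s * N (\<lambda>t. 1) \<le> s * (N (\<lambda>t. 1) + 1)" using s by (intro mult_left_mono) auto
    also have "\<dots> = e / 2" using N1 by (simp add: s_def field_simps)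
    finally show ?thesis .
  qed
  obtain d where d: "0 < d" "\<And>A. A \<in> sets M \<Longrightarrow> emeasure M A < ennreal d \<Longrightarrow>
      indicator A \<in> E \<and> N (indicator A) < e / (2 * (K + 1))"
    using small[of "e / (2 * (K + 1))"] e K by auto
  define F where "F k = A k \<inter> {t \<in> space M. s < x t}" for k
  have F_sets: "F k \<in> sets M" for k unfolding F_def by measurable
  have UN_F: "(\<Union>k. F k) = (\<Union>k. A k) \<inter> {t \<in> space M. s < x t}" unfolding F_def by blast
  have "(\<lambda>k. measure M (F k)) sums measure M (\<Union>k. F k)"
  proof (rule measure_UNION)
    show "disjoint_family F" using A(2) unfolding F_def disjoint_family_on_def by blast
    show "emeasure M (\<Union>k. F k) \<noteq> \<infinity>" unfolding UN_F using fin[OF s] by simp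
  qed (use F_sets in blast)
  then have "(\<lambda>k. measure M (F k)) \<longlonglongrightarrow> 0" by (intro summable_LIMSEQ_zero) (rule sums_summable)
  then have "eventually (\<lambda>k. measure M (F k) < d) sequentially" using d(1) by (rule order_tendstoD)
  then obtain k where k: "measure M (F k) < d" by (auto simp: eventually_sequentially)
  have "emeasure M (F k) < \<infinity>"
    using emeasure_mono[of "F k" "\<Union>k. F k" M] F_sets fin[OF s] unfolding UN_F[symmetric]
    by (auto intro: le_less_trans)
  then have "emeasure M (F k) < ennreal d"
    using k d(1) by (simp add: emeasure_eq_ennreal_measure ennreal_less_iff)
  then have Fk: "indicator (F k) \<in> E" "N (indicator (F k)) < e / (2 * (K + 1))"
    using d(2) F_sets by auto
  have KN: "K * N (indicator (F k)) \<le> e / 2"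
  proof -
    have "K * N (indicator (F k)) \<le> (K + 1) * (e / (2 * (K + 1)))"
      using K Fk N_nonneg[OF Fk(1)] by (intro mult_mono) auto
    also have "\<dots> = e / 2" using K by (simp add: field_simps)
    finally show ?thesis .
  qed
  let ?L = "(\<Union>k. A k) \<inter> {t \<in> space M. K < x t}"
  define l where "l t = indicator ?L t * x t" for t
  have l: "l \<in> E" unfolding l_def by (rule E_ideal[OF _ x(1)]) (auto simp: indicator_def)
  have sum_E: "(\<lambda>t. s * 1 + K * indicator (F k) t) \<in> E"
    by (intro E_add E_scale one Fk(1))
  have "1 \<le> N (\<lambda>t. indicator (A k) t * x t)" by (rule A(3))
  also have "\<dots> \<le> N (\<lambda>t. l t + (s * 1 + K * indicator (F k) t))"
  proof (rule N_le)
    show "(\<lambda>t. l t + (s * 1 + K * indicator (F k) t)) \<in> E" by (intro E_add[OF l sum_E])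
    show "AE t in M. \<bar>indicator (A k) t * x t\<bar> \<le> \<bar>l t + (s * 1 + K * indicator (F k) t)\<bar>"
      using AE_space
    proof eventually_elim
      case (elim t)
      then show ?case using x(2)[of t] s K unfolding l_def F_def by (auto simp: indicator_def)
    qed
  qed measurable
  also have "\<dots> \<le> N l + N (\<lambda>t. s * 1 + K * indicator (F k) t)" by (rule triangle[OF l sum_E])
  also have "N (\<lambda>t. s * 1 + K * indicator (F k) t) \<le> N (\<lambda>t. s * 1) + N (\<lambda>t. K * indicator (F k) t)"
    by (intro triangle E_scale one Fk(1))
  also have "N (\<lambda>t. s * 1) = s * N (\<lambda>t. 1)" using N_scale[OF one, of s] s by simp
  also have "N (\<lambda>t. K * indicator (F k) t) = K * N (indicator (F k))"
    using N_scale[OF Fk(1), of K] K by simp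
  finally show "1 \<le> N (\<lambda>t. indicator ?L t * x t) + e" using sN KN unfolding l_def by simp
qed

end

text \<open>
  If \<open>x\<close> exceeds \<open>c\<close> on a set of infinite measure, raising \<open>x\<close> to at least \<open>c\<close> changes only level sets
  that already have infinite measure.
\<close>

lemma equimeasurable_raise_levels:
  fixes B :: "nat \<Rightarrow> 'a set" and x y :: "'a \<Rightarrow> real"
  assumes meas: "x \<in> borel_measurable M" "y \<in> borel_measurable M"
    and B: "\<And>n. B n \<in> sets M" "disjoint_family B"
    and x: "\<And>t. 0 \<le> x t" "\<And>t. t \<notin> (\<Union>n. B n) \<Longrightarrow> x t = 0"
    and y: "\<And>n t. t \<in> B n \<Longrightarrow> y t = max (x t) (c n)" "\<And>t. t \<notin> (\<Union>n. B n) \<Longrightarrow> y t = 0"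
    and c: "\<And>n. c n = 0 \<or> 0 < c n \<and> emeasure M (B n \<inter> {t \<in> space M. c n < x t}) = \<infinity>"
  shows "equimeasurable M x y"
  unfolding equimeasurable_def
proof (intro allI impI)
  fix s :: real assume s: "0 \<le> s"
  have [measurable]: "x \<in> borel_measurable M" "y \<in> borel_measurable M" "\<And>n. B n \<in> sets M" by fact+
  have level: "emeasure M {t \<in> space M. s < \<bar>u t\<bar>} = (\<Sum>n. emeasure M (B n \<inter> {t \<in> space M. s < \<bar>u t\<bar>}))"
    if "\<And>t. t \<notin> (\<Union>n. B n) \<Longrightarrow> u t = 0" and [measurable]: "u \<in> borel_measurable M" for u :: "'a \<Rightarrow> real"
  proof -
    have "{t \<in> space M. s < \<bar>u t\<bar>} = (\<Union>n. B n \<inter> {t \<in> space M. s < \<bar>u t\<bar>})"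
      using that(1) s by force
    also have "emeasure M \<dots> = (\<Sum>n. emeasure M (B n \<inter> {t \<in> space M. s < \<bar>u t\<bar>}))"
      using B(2) by (intro suminf_emeasure[symmetric]) (auto simp: disjoint_family_on_def)
    finally show ?thesis .
  qed
  have "emeasure M (B n \<inter> {t \<in> space M. s < \<bar>x t\<bar>}) = emeasure M (B n \<inter> {t \<in> space M. s < \<bar>y t\<bar>})" for n
  proof (cases "c n \<le> s")
    case True
    have "s < \<bar>x t\<bar> \<longleftrightarrow> s < \<bar>y t\<bar>" if "t \<in> B n" for t
      using y(1)[OF that] x(1)[of t] True by (auto simp: max_def)
    then have "B n \<inter> {t \<in> space M. s < \<bar>x t\<bar>} = B n \<inter> {t \<in> space M. s < \<bar>y t\<bar>}"
      by auto
    then show ?thesis by simp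
  next
    case False
    then have inf: "emeasure M (B n \<inter> {t \<in> space M. c n < x t}) = \<infinity>" using c[of n] s by auto
    have "B n \<inter> {t \<in> space M. c n < x t} \<subseteq> B n \<inter> {t \<in> space M. s < \<bar>x t\<bar>}"
      "B n \<inter> {t \<in> space M. c n < x t} \<subseteq> B n \<inter> {t \<in> space M. s < \<bar>y t\<bar>}"
      using False y(1) x(1) by (auto simp: max_def)
    then have "emeasure M (B n \<inter> {t \<in> space M. c n < x t}) \<le> emeasure M (B n \<inter> {t \<in> space M. s < \<bar>x t\<bar>})"
      "emeasure M (B n \<inter> {t \<in> space M. c n < x t}) \<le> emeasure M (B n \<inter> {t \<in> space M. s < \<bar>y t\<bar>})"
      by (auto intro!: emeasure_mono)
    then show ?thesis unfolding inf by (simp add: top_unique)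
  qed
  then show "emeasure M {t \<in> space M. s < \<bar>x t\<bar>} = emeasure M {t \<in> space M. s < \<bar>y t\<bar>}"
    using level[of x] level[of y] x(2) y(2) meas by simp
qed

context orlicz_space
begin

text \<open>
  Growth of \<open>\<phi>\<close> at infinity says nothing about small values of \<open>x\<close>, which have to be avoided.  The
  blocks \<open>A n\<close> are grouped into infinitely many infinite unions \<open>B n\<close>.  If \<open>x\<close> exceeds some \<open>c > 0\<close> on a
  subset of \<open>B n\<close> of infinite measure, then \<open>x\<close> is raised to \<open>max x c\<close> on \<open>B n\<close>, which does not change
  its distribution, and all values on \<open>B n\<close> become bounded below.  Otherwise the large values of \<open>x\<close>
  carry the whole norm on \<open>B n\<close> by \<open>norm_of_large_part\<close>.
\<close>

lemma linf_copy_of_Delta_eps_infinity: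
  assumes copy: "contains_linf_copy M E N" and \<Delta>: "Delta_eps_infinity \<phi>"
    and mono: "strict_mono_on {u. a_phi \<phi> < ereal u \<and> ereal u < b_phi \<phi>} \<phi>"
    and ri: "ri_Banach_space M E N" and one: "(\<lambda>t. 1) \<in> E"
    and small: "\<And>e. 0 < e \<Longrightarrow>
      \<exists>d>0. \<forall>A\<in>sets M. emeasure M A < ennreal d \<longrightarrow> indicator A \<in> E \<and> N (indicator A) < e"
  shows "contains_linf_copy M (E_phi M E N \<phi>) (norm_phi M E N \<phi>)"
proof -
  have norm: "norm_on M E N" using ri unfolding ri_Banach_space_def by blast
  obtain x A where x: "x \<in> E" "\<And>t. 0 \<le> x t" "N x \<le> 1"
    and A: "\<And>n::nat. A n \<in> sets M" "disjoint_family A" "\<And>n. 1 \<le> N (\<lambda>t. indicator (A n) t * x t)"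
    by (rule linf_copy_disjoint_blocks[OF copy]) blast
  have [measurable]: "x \<in> borel_measurable M" "A n \<in> sets M" for n
    using E_measurable[OF x(1)] A(1) by auto
  define A' where "A' n k = A (prod_encode (n, k))" for n k
  define B where "B n = (\<Union>k. A' n k)" for n
  have A'_disj: "disjoint_family (A' n)" for n
    using A(2) unfolding A'_def disjoint_family_on_def by (simp add: prod_encode_eq)
  have B_sets [measurable]: "B n \<in> sets M" for n unfolding B_def A'_def by measurable
  have "A' m k \<inter> A' n j = {}" if "m \<noteq> n" for m n k j
    using A(2) that unfolding A'_def disjoint_family_on_def by (simp add: prod_encode_eq)
  then have B_disj: "disjoint_family B"
    unfolding B_def disjoint_family_on_def by blast
  define inf where "inf n c \<longleftrightarrow> 0 < c \<and> emeasure M (B n \<inter> {t \<in> space M. c < x t}) = \<infinity>" for n and c :: real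
  \<comment> \<open>The value \<open>0\<close> marks the unions on which \<open>x\<close> is left as it is; there \<open>max x 0 = x\<close>.\<close>
  define c where "c n = (if \<exists>c. inf n c then SOME c. inf n c else 0)" for n
  have c: "c n = 0 \<and> (\<forall>c. \<not> inf n c) \<or> inf n (c n)" for n
    unfolding c_def by (auto intro: someI)
  define idx where "idx t = (LEAST n. t \<in> B n)" for t
  have [measurable]: "idx \<in> measurable M (count_space UNIV)"
    unfolding idx_def by measurable
  note idx_eq = Least_index_disjoint_family[OF B_disj, folded idx_def]
  define u where "u t = indicator (\<Union>n. B n) t * x t" for t
  define y where "y t = indicator (\<Union>n. B n) t * max (x t) (c (idx t))" for t
  have [measurable]: "u \<in> borel_measurable M" "y \<in> borel_measurable M"
    unfolding u_def y_def by measurable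
  have y_eq: "y t = max (x t) (c n)" if "t \<in> B n" for t n
    using that idx_eq[OF that] unfolding y_def by (auto simp: indicator_def)
  have y_nonneg: "0 \<le> y t" for t using x(2)[of t] unfolding y_def by (auto simp: indicator_def)
  have "equimeasurable M u y"
  proof (rule equimeasurable_raise_levels[OF _ _ B_sets B_disj])
    show "c n = 0 \<or> 0 < c n \<and> emeasure M (B n \<inter> {t \<in> space M. c n < u t}) = \<infinity>" for n
    proof -
      have "B n \<inter> {t \<in> space M. c n < u t} = B n \<inter> {t \<in> space M. c n < x t}"
        unfolding u_def by (auto simp: indicator_def)
      then show ?thesis using c[of n] unfolding inf_def by auto
    qed
    show "y t = max (u t) (c n)" if "t \<in> B n" for t n
      using y_eq[OF that] that unfolding u_def by (auto simp: indicator_def)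
  qed (use x(2) in \<open>auto simp: u_def y_def\<close>)
  moreover have "u \<in> E" "N u \<le> N x"
    unfolding u_def by (auto intro!: E_ideal[OF _ x(1)] N_le[OF _ x(1)] simp: indicator_def)
  ultimately have y: "y \<in> E" "N y \<le> 1"
    using ri x(3) unfolding ri_Banach_space_def by auto
  have B_norm: "1 \<le> N (\<lambda>t. indicator (B n) t * y t)" for n
  proof -
    have "1 \<le> N (\<lambda>t. indicator (A' n 0) t * x t)" unfolding A'_def by (rule A(3))
    also have "\<dots> \<le> N (\<lambda>t. indicator (B n) t * y t)"
    proof (rule N_le)
      show "(\<lambda>t. indicator (B n) t * y t) \<in> E"
        by (rule E_ideal[OF _ y(1)]) (auto simp: indicator_def)
      have "\<bar>indicator (A' n 0) t * x t\<bar> \<le> \<bar>indicator (B n) t * y t\<bar>" for t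
      proof (cases "t \<in> A' n 0")
        case True
        then have "t \<in> B n" unfolding B_def by blast
        then show ?thesis using True y_eq[of t n] x(2)[of t] by simp
      qed simp
      then show "AE t in M. \<bar>indicator (A' n 0) t * x t\<bar> \<le> \<bar>indicator (B n) t * y t\<bar>" by simp
    qed (unfold A'_def, measurable)
    finally show ?thesis .
  qed
  show ?thesis
  proof (rule linf_copy_criterion[OF y(1) y_nonneg y(2) B_sets B_disj])
    fix n :: nat and l :: real assume l: "1 < l"
    show "\<exists>\<delta>\<in>{0<..<1}. \<exists>D\<in>sets M. D \<subseteq> B n \<and> 1 \<le> N (\<lambda>t. indicator D t * y t) \<and>
      (AE t in M. t \<in> D \<longrightarrow> \<phi> (\<psi> (y t)) \<le> ennreal \<delta> * \<phi> (l * \<psi> (y t)))"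
    proof (cases "inf n (c n)")
      case True
      then have "0 < c n" unfolding inf_def by blast
      then obtain d where d: "d \<in> {0<..<1}" "\<And>v. c n \<le> v \<Longrightarrow> \<phi> (\<psi> v) \<le> ennreal d * \<phi> (l * \<psi> v)"
        using gain_at_values_bounded_below[OF \<Delta> l _ mono] by blast
      have "AE t in M. t \<in> B n \<longrightarrow> \<phi> (\<psi> (y t)) \<le> ennreal d * \<phi> (l * \<psi> (y t))"
        using d(2) y_eq by simp
      then show ?thesis using d(1) B_norm B_sets by blast
    next
      case False
      then have c0: "c n = 0" and fin: "\<And>c. \<not> inf n c" using c[of n] by auto
      have y_x: "y t = x t" if "t \<in> B n" for t using y_eq[OF that] c0 x(2)[of t] by simp
      obtain K d where K: "0 \<le> K" and d: "d \<in> {0<..<1}"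
        "\<And>v. K < v \<Longrightarrow> \<phi> (\<psi> v) \<le> ennreal d * \<phi> (l * \<psi> v)"
        using gain_at_large_values[OF \<Delta> l] by blast
      define D where "D = B n \<inter> {t \<in> space M. K < x t}"
      have D_sets: "D \<in> sets M" unfolding D_def by measurable
      have "1 \<le> N (\<lambda>t. indicator D t * x t)"
        unfolding D_def B_def
      proof (rule norm_of_large_part[OF norm one small x(1,2) _ A'_disj _ _ K])
        show "emeasure M ((\<Union>k. A' n k) \<inter> {t \<in> space M. c < x t}) < \<infinity>" if "0 < c" for c
          using fin[of c] that unfolding inf_def B_def by (simp add: less_top)
      qed (auto simp: A'_def A)
      moreover have "(\<lambda>t. indicator D t * x t) = (\<lambda>t. indicator D t * y t)"
        using y_x unfolding D_def by (auto simp: indicator_def)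
      moreover have "AE t in M. t \<in> D \<longrightarrow> \<phi> (\<psi> (y t)) \<le> ennreal d * \<phi> (l * \<psi> (y t))"
        using d(2) y_x unfolding D_def by simp
      moreover have "D \<subseteq> B n" unfolding D_def by blast
      ultimately show ?thesis using d(1) D_sets by (intro bexI[of _ d] bexI[of _ D] conjI) auto
    qed
  qed
qed

end

section \<open>Copies of $l_\infty$ in the Orlicz space\<close>

theorem theorem5p19:
  fixes M :: "'a measure"
    and E :: "('a \<Rightarrow> real) set"
    and N :: "('a \<Rightarrow> real) \<Rightarrow> real"
    and \<phi> :: "real \<Rightarrow> ennreal"
    and \<alpha> :: ereal
  assumes "base_measure_space M"
    and "quasi_Banach_ideal_space M E N"
    and "Fatou_property M E N"
    and "orlicz_function \<phi>"
    and "a_phi \<phi> < b_phi \<phi>"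
    and "is_alpha_E M E \<phi> \<alpha>" and "\<alpha> > 0"
    and "(\<not> Linf M \<subseteq> E \<and> \<not> E \<subseteq> Linf M \<and> Delta_eps \<phi>) \<or>
         (Linf M \<subseteq> E \<and>
           (Delta_eps \<phi> \<or>
            (Delta_eps_infinity \<phi> \<and>
             strict_mono_on {u. a_phi \<phi> < ereal u \<and> ereal u < b_phi \<phi>} \<phi> \<and>
             ri_Banach_space M E N \<and>
             (is_Lebesgue_on M {0<..<1} \<or> is_Lebesgue_on M {0<..}) \<and>
             same_support M (order_cont_part M E N) E))) \<or>
         (E \<subseteq> Linf M \<and> Delta_eps_zero \<phi> \<and>
           strict_mono_on
             {u. a_phi \<phi> < ereal u \<and>
                 ereal u < min (ereal (phi_inv \<phi> (1 / a_const M E N))) (b_phi \<phi>)} \<phi>)"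
    and "contains_linf_copy M E N"
  shows "contains_linf_copy M (E_phi M E N \<phi>) (norm_phi M E N \<phi>)"
proof -
  interpret orlicz_space M E N \<phi>
    using assms(2,4,5) by unfold_locales
  have pos: "emeasure M (space M) > 0" using assms(1) unfolding base_measure_space_def by blast
  consider "Delta_eps \<phi>"
    | "Linf M \<subseteq> E" "Delta_eps_infinity \<phi>"
      "strict_mono_on {u. a_phi \<phi> < ereal u \<and> ereal u < b_phi \<phi>} \<phi>" "ri_Banach_space M E N"
      "is_Lebesgue_on M {0<..<1} \<or> is_Lebesgue_on M {0<..}"
      "same_support M (order_cont_part M E N) E"
    | "E \<subseteq> Linf M" "Delta_eps_zero \<phi>"
      "strict_mono_on {u. a_phi \<phi> < ereal u \<and>
         ereal u < min (ereal (phi_inv \<phi> (1 / a_const M E N))) (b_phi \<phi>)} \<phi>"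
    using assms(8) by blast
  then show ?thesis
  proof cases
    case 1
    then show ?thesis by (rule linf_copy_of_Delta_eps[OF assms(9)])
  next
    case 2
    obtain I :: "real set" where I: "is_Lebesgue_on M I" "I \<in> sets lborel" "I \<subseteq> {0<..}"
      using 2(5)
    proof
      assume "is_Lebesgue_on M {0<..<1}"
      then show ?thesis by (rule that) auto
    next
      assume "is_Lebesgue_on M {0<..}"
      then show ?thesis by (rule that) auto
    qed
    obtain z where z: "z \<in> order_cont_part M E N" "\<not> (AE t in M. z t = 0)"
      by (rule order_cont_part_nontrivial[OF pos 2(6)])
    have "(\<lambda>t. 1) \<in> Linf M" unfolding Linf_def by auto
    then have one: "(\<lambda>t. 1) \<in> E" using 2(1) by blast
    show ?thesis
      by (rule linf_copy_of_Delta_eps_infinity[OF assms(9) 2(2,3,4) one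
            indicator_norm_small[OF 2(4) I z]])
  next
    case 3
    show ?thesis by (rule linf_copy_of_Delta_eps_zero[OF assms(9) 3(2) pos 3(1,3)])
  qed
qed

end
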